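(* Let $0\le r\le n$. As a subvariety of $\mathrm{Gr}(r;n)$, the quasisymmetric Grassmannian $\mathrm{QGr}(r;n)$ is the common vanishing locus of the products of Plücker coordinates $$\{\Delta_A\Delta_B\mid AB\in E(J_{r,n})\setminus E(QJ_{r,n})\},$$ where $J_{r,n}$ is the Johnson graph and $QJ_{r,n}$ is the quasisymmetric Johnson graph. (Equality is as closed subsets of $\mathrm{Gr}(r;n)$.)
   Context: **Noncrossing partitions.** $[n]=\{1,\dots,n\}$. $\mathrm{NC}_n\subset S_n$ is the set of permutations obtained from noncrossing set partitions of $[n]$ by turning each block $\{b_1<\cdots<b_s\}$ into the cycle $(b_s\,b_{s-1}\,\cdots\,b_1)$ (so $b_s\mapsto b_{s-1}\mapsto\cdots\mapsto b_1\mapsto b_s$) and multiplying these cycles. For $w\in S_n$, $\mathrm{Inv}(w)=\{(i,j)\mid i<j,\ w^{-1}(i)>w^{-1}(j)\}$. For $w\in \mathrm{NC}_n$, $\mathrm{Inv}_{\mathrm{NC}}(w)=\{(i,j)\in\mathrm{Inv}(w)\mid (i\,j)w\in\mathrm{NC}_n\}$. Two elements $u,w\in\mathrm{NC}_n$ are Kreweras-adjacent if $w=\tau u$ for some transposition $\tau$. **Graphs.** The Johnson graph $J_{r,n}$ has vertex set $\binom{[n]}{r}$ ($r$-element subsets of $[n]$), with an edge $AB$ whenever $B=(A\setminus j)\cup i$ for some $j\in A$, $i\notin A$. The quasisymmetric Johnson graph $QJ_{r,n}$ is the spanning subgraph of $J_{r,n}$ whose edges are those $AB\in E(J_{r,n})$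 for which there are Kreweras-adjacent $w,u\in\mathrm{NC}_n$ with $A=w\cdot[r]$, $B=u\cdot[r]$ (where $w\cdot[r]=\{w(1),\dots,w(r)\}$). **Quasisymmetric flag variety and Grassmannian.** $\mathrm{Fl}_n=\mathrm{GL}_n(\mathbb C)/B$ ($B$ upper triangular); $MB$ corresponds to the flag with $V_i$ the span of the first $i$ columns of $M$. For $w\in\mathrm{NC}_n$, $\mathring X^w_{\mathrm{NC}}\subset \mathrm{Fl}_n$ is the set of flags represented by matrices with entry $1$ in positions $(w(j),j)$, arbitrary complex entries in positions $(i,w^{-1}(j))$ for $(i,j)\in\mathrm{Inv}_{\mathrm{NC}}(w)$, and $0$ elsewhere. The quasisymmetric flag variety is the (closed) subvariety $\mathrm{QFl}_n=\bigsqcup_{w\in\mathrm{NC}_n}\mathring X^w_{\mathrm{NC}}$. With $\pi:\mathrm{Fl}_n\to\mathrm{Gr}(r;n)$, $V_\bullet\mapsto V_r$, one sets $\mathrm{QGr}(r;n):=\pi(\mathrm{QFl}_n)$. **Plücker coordinates.** For a point of $\mathrm{Gr}(r;n)$ (the $r$-planes in $\mathbb C^n$) given as the column span of a full rank $n\times r$ matrix $M$, $\Delta_A=\det(M_{i,j})_{i\in A,\,j\in[r]}$ for $A\in\binom{[n]}{r}$, well defined up to simultaneous scaling. *)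

theory Defs
  imports
    "HOL-Library.Disjoint_Sets"
    "HOL-Combinatorics.Cycles"
    "Jordan_Normal_Form.DL_Rank_Submatrix"
begin

text \<open>Everything is indexed from \<open>0\<close>, as matrices are in the library: \<open>{..<n}\<close> stands for
  \<open>[n] = {1, ..., n}\<close> and \<open>{..<r}\<close> for \<open>[r]\<close>, via the order isomorphism \<open>i \<mapsto> i + 1\<close>.
  Elements of the symmetric group are functions on \<^typ>\<open>nat\<close> that fix every point outside
  \<open>{..<n}\<close>; their product is composition, the right factor acting first.\<close>

section \<open>Noncrossing partitions\<close>

definition noncrossing :: "nat set set \<Rightarrow> bool" where
  "noncrossing P \<longleftrightarrow>
     (\<forall>B\<in>P. \<forall>C\<in>P. \<forall>a\<in>B. \<forall>b\<in>C. \<forall>c\<in>B. \<forall>d\<in>C. a < b \<and> b < c \<and> c < d \<longrightarrow> B = C)"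

text \<open>\<^const>\<open>cycle_of_list\<close> sends each entry of the list to the next one and the last to the
  first, hence the reversal.\<close>

definition block_cycle :: "nat set \<Rightarrow> nat \<Rightarrow> nat" where
  "block_cycle B = cycle_of_list (rev (sorted_list_of_set B))"

text \<open>The blocks are listed in an arbitrary order: their cycles are disjoint, so they commute.\<close>

definition NC :: "nat \<Rightarrow> (nat \<Rightarrow> nat) set" where
  "NC n = {foldr (\<circ>) (map block_cycle Bs) id | Bs.
             distinct Bs \<and> partition_on {..<n} (set Bs) \<and> noncrossing (set Bs)}"

definition Inv :: "nat \<Rightarrow> (nat \<Rightarrow> nat) \<Rightarrow> (nat \<times> nat) set" where
  "Inv n w = {(i, j). i < n \<and> j < n \<and> i < j \<and> Hilbert_Choice.inv w i > Hilbert_Choice.inv w j}"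

definition Inv_NC :: "nat \<Rightarrow> (nat \<Rightarrow> nat) \<Rightarrow> (nat \<times> nat) set" where
  "Inv_NC n w = {(i, j) \<in> Inv n w. Transposition.transpose i j \<circ> w \<in> NC n}"

definition kreweras_adjacent :: "nat \<Rightarrow> (nat \<Rightarrow> nat) \<Rightarrow> (nat \<Rightarrow> nat) \<Rightarrow> bool" where
  "kreweras_adjacent n u w \<longleftrightarrow> u \<in> NC n \<and> w \<in> NC n \<and>
     (\<exists>i<n. \<exists>j<n. i \<noteq> j \<and> w = Transposition.transpose i j \<circ> u)"


section \<open>Johnson graphs\<close>

definition subsets_of_size :: "nat \<Rightarrow> nat \<Rightarrow> nat set set" where
  "subsets_of_size r n = {A. A \<subseteq> {..<n} \<and> card A = r}"

definition johnson_edges :: "nat \<Rightarrow> nat \<Rightarrow> nat set set set" where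
  "johnson_edges r n = {{A, B} | A B. A \<in> subsets_of_size r n \<and> B \<in> subsets_of_size r n \<and>
     (\<exists>j\<in>A. \<exists>i\<in>{..<n} - A. B = insert i (A - {j}))}"

definition quasisymmetric_johnson_edges :: "nat \<Rightarrow> nat \<Rightarrow> nat set set set" where
  "quasisymmetric_johnson_edges r n = {{A, B} | A B. {A, B} \<in> johnson_edges r n \<and>
     (\<exists>w u. kreweras_adjacent n w u \<and> A = w ` {..<r} \<and> B = u ` {..<r})}"


section \<open>Flags and the Grassmannian\<close>

abbreviation cspan :: "nat \<Rightarrow> complex vec set \<Rightarrow> complex vec set" where
  "cspan n S \<equiv> LinearCombinations.module.span class_ring (module_vec TYPE(complex) n) S"

text \<open>The flag \<open>V\<^sub>0 \<subseteq> V\<^sub>1 \<subseteq> \<dots> \<subseteq> V\<^sub>n\<close> is the function \<open>k \<mapsto> V\<^sub>k\<close>, constant from \<open>k = n\<close> on.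
  Two invertible matrices have the same flag iff they agree up to right multiplication by an
  invertible upper triangular matrix, so \<open>Fl n\<close> below is \<open>GL\<^sub>n / B\<close>.\<close>

definition flag_of :: "nat \<Rightarrow> complex mat \<Rightarrow> nat \<Rightarrow> complex vec set" where
  "flag_of n M k = cspan n (set (take k (cols M)))"

definition Fl :: "nat \<Rightarrow> (nat \<Rightarrow> complex vec set) set" where
  "Fl n = flag_of n ` {M \<in> carrier_mat n n. invertible_mat M}"

definition Gr :: "nat \<Rightarrow> nat \<Rightarrow> complex vec set set" where
  "Gr r n = {W. VectorSpace.subspace class_ring W (module_vec TYPE(complex) n) \<and>
     vectorspace.dim class_ring ((module_vec TYPE(complex) n)\<lparr>carrier := W\<rparr>) = r}"

definition nc_matrices :: "nat \<Rightarrow> (nat \<Rightarrow> nat) \<Rightarrow> complex mat set" where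
  "nc_matrices n w = {M \<in> carrier_mat n n.
     (\<forall>j<n. M $$ (w j, j) = 1) \<and>
     (\<forall>i<n. \<forall>k<n. i \<noteq> w k \<and> (i, k) \<notin> {(i, Hilbert_Choice.inv w j) | i j. (i, j) \<in> Inv_NC n w}
        \<longrightarrow> M $$ (i, k) = 0)}"

definition nc_cell :: "nat \<Rightarrow> (nat \<Rightarrow> nat) \<Rightarrow> (nat \<Rightarrow> complex vec set) set" where
  "nc_cell n w = {V \<in> Fl n. \<exists>M\<in>nc_matrices n w. V = flag_of n M}"

definition QFl :: "nat \<Rightarrow> (nat \<Rightarrow> complex vec set) set" where
  "QFl n = (\<Union>w\<in>NC n. nc_cell n w)"

definition flag_proj :: "nat \<Rightarrow> (nat \<Rightarrow> complex vec set) \<Rightarrow> complex vec set" where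
  "flag_proj r V = V r"

definition QGr :: "nat \<Rightarrow> nat \<Rightarrow> complex vec set set" where
  "QGr r n = flag_proj r ` QFl n"


section \<open>Pluecker coordinates\<close>

definition plucker_rep :: "nat \<Rightarrow> nat \<Rightarrow> complex vec set \<Rightarrow> complex mat \<Rightarrow> bool" where
  "plucker_rep r n W M \<longleftrightarrow> M \<in> carrier_mat n r \<and> vec_space.rank n M = r \<and> W = cspan n (set (cols M))"

definition plucker :: "complex mat \<Rightarrow> nat set \<Rightarrow> complex" where
  "plucker M A = det (submatrix M A UNIV)"

lemma Gr_plucker_rep:
  assumes W: "W \<in> Gr r n"
  shows "\<exists>M. plucker_rep r n W M"
proof -
  interpret vec_space "TYPE(complex)" n .
  have sub: "VectorSpace.subspace class_ring W V"
    and dimW: "vectorspace.dim class_ring (vs W) = r"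
    using W by (auto simp: Gr_def)
  have subm: "submodule class_ring W V"
    using sub by (simp add: VectorSpace.subspace_def)
  have WV: "W \<subseteq> carrier_vec n"
    using subm by (auto simp: submodule_def)
  let ?P = "\<lambda>B. B \<subseteq> W \<and> lin_indpt B"
  have P0: "?P {}" by (simp add: lin_dep_def)
  have bd: "\<forall>B. ?P B \<longrightarrow> card B \<le> dim"
    using li_le_dim(2)[OF fin_dim] WV by auto
  obtain B where B: "?P B" and max: "\<forall>C. ?P C \<longrightarrow> card C \<le> card B"
    using ex_has_greatest_nat[of ?P "{}" card "Suc dim"] P0 bd by (metis le_imp_less_Suc)
  have BV: "B \<subseteq> carrier_vec n" using B WV by auto
  have finB: "finite B" using li_le_dim(1)[OF fin_dim] BV B by auto
  have le: "span B \<subseteq> W"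
    using B subm by (intro span_is_subset) auto
  have ge: "W \<subseteq> span B"
  proof
    fix w assume w: "w \<in> W"
    show "w \<in> span B"
    proof (rule ccontr)
      assume nw: "w \<notin> span B"
      then have nB: "w \<notin> B" using in_own_span[of B] BV by auto
      have "lin_indpt (insert w B)"
        using lin_dep_iff_in_span[of B w] BV B nB nw w WV by auto
      then have "card (insert w B) \<le> card B" using max B w by auto
      then show False using nB finB by simp
    qed
  qed
  have span: "span B = W" using le ge by auto
  obtain bs where bs: "set bs = B" "distinct bs"
    using finite_distinct_list[OF finB] by blast
  let ?M = "mat_of_cols n bs"
  have cols: "cols ?M = bs" using bs BV by (intro cols_mat_of_cols) auto
  have M: "?M \<in> carrier_mat n (length bs)" by simp
  have rank: "rank ?M = length bs"
    using lin_indpt_full_rank[OF M] cols bs B by auto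
  have "rank ?M = r" using dimW by (simp add: rank_def cols bs span)
  with rank have len: "length bs = r" by simp
  show ?thesis
    using M rank len cols bs span by (intro exI[of _ ?M]) (auto simp: plucker_rep_def)
qed

text \<open>Pluecker coordinates are defined only up to a common nonzero factor. Whether a product of
  two of them vanishes does not depend on the representing matrix, and by \<open>Gr_plucker_rep\<close>
  every point has one, so the universal quantifier over representatives is not vacuous.\<close>

definition plucker_products_locus :: "nat \<Rightarrow> nat \<Rightarrow> nat set set set \<Rightarrow> complex vec set set" where
  "plucker_products_locus r n E = {W \<in> Gr r n. \<forall>A B. {A, B} \<in> E \<longrightarrow>
     (\<forall>M. plucker_rep r n W M \<longrightarrow> plucker M A * plucker M B = 0)}"

end

theory Submission
  imports Defs
begin

text \<open>For an \<open>r\<close>-subset \<open>A\<close>, let \<open>x\<^sub>1 < \<dots> < x\<^sub>q\<close> be the elements of \<open>[r] - A\<close> and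
  \<open>z\<^sub>1 > \<dots> > z\<^sub>q\<close> those of \<open>A - [r]\<close>. Give \<open>z\<^sub>p\<close> level \<open>2p\<close>, \<open>x\<^sub>p\<close> level \<open>2p + 1\<close>, and every
  other point the level of the last of these points that it passes (moving up in \<open>[r]\<close> and down
  outside; level \<open>1\<close> or \<open>0\<close> if there is none). The key fact is that for \<open>i < j\<close>, \<open>j \<in> A\<close>, \<open>i \<notin> A\<close>, the sets \<open>A\<close> and \<open>A - j + i\<close> are
  joined in the quasisymmetric Johnson graph iff the levels of \<open>i\<close> and \<open>j\<close> differ by at most one;
  moreover a single noncrossing permutation \<open>w\<close> with \<open>w[r] = A\<close> realises all these edges.

  A point of the cell of \<open>w\<close> satisfies the equations: a nonzero minor \<open>\<Delta>\<^sub>B\<close> has a nonzero Leibniz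
  term, which moves \<open>A = w[r]\<close> to \<open>B\<close> by exchanges of this kind. Listing the points by level, this forces
  \<open>|B \<inter> T| - |[r] \<inter> T| \<in> {0, 1}\<close> for every initial segment \<open>T\<close> of the list, and two Johnson neighbours
  with this property have close levels with respect to each other.

  Conversely, let a point satisfy the equations, and let \<open>A\<close> be of maximal element sum with \<open>\<Delta>\<^sub>A \<noteq> 0\<close>.
  The nonzero entries of the basis reduced at \<open>A\<close> are ratios \<open>\<plusminus>\<Delta>\<^sub>B / \<Delta>\<^sub>A\<close> for neighbours \<open>B\<close> of \<open>A\<close> with smaller
  sum, so they sit in positions allowed in the cell of the permutation \<open>w\<close> above.\<close>

section \<open>Noncrossing permutations\<close>

text \<open>A partition is represented by a labelling whose level sets are its blocks, which avoids
  handling lists of blocks.\<close>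

definition label_perm :: "nat \<Rightarrow> (nat \<Rightarrow> 'a) \<Rightarrow> nat \<Rightarrow> nat" where
  "label_perm n f k = (if k < n then
     if \<exists>l<k. f l = f k then Max {l. l < k \<and> f l = f k} else Max {l. l < n \<and> f l = f k}
   else k)"

definition nc_label :: "nat \<Rightarrow> (nat \<Rightarrow> 'a) \<Rightarrow> bool" where
  "nc_label n f \<longleftrightarrow> (\<forall>a b c d. a < b \<and> b < c \<and> c < d \<and> d < n \<and> f a = f c \<and> f b = f d \<longrightarrow> f a = f b)"

lemma label_perm_outside: "k \<ge> n \<Longrightarrow> label_perm n f k = k"
  by (simp add: label_perm_def)

text \<open>\<open>pred\<close> is the step down to the preceding element of the block,
  \<open>wrap\<close> the step from its minimum to its maximum. A fixed point falls under
  \<open>wrap\<close>, hence the weak inequality there.\<close>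

lemma label_perm_cases:
  assumes "k < n"
  obtains (pred) "label_perm n f k < k" "f (label_perm n f k) = f k"
      "\<And>l. label_perm n f k < l \<Longrightarrow> l < k \<Longrightarrow> f l \<noteq> f k"
    | (wrap) "k \<le> label_perm n f k" "label_perm n f k < n" "f (label_perm n f k) = f k"
      "\<And>l. l < n \<Longrightarrow> f l = f k \<Longrightarrow> k \<le> l \<and> l \<le> label_perm n f k"
proof (cases "\<exists>l<k. f l = f k")
  case True
  let ?L = "{l. l < k \<and> f l = f k}"
  have eq: "label_perm n f k = Max ?L" using True assms by (simp add: label_perm_def)
  have "Max ?L \<in> ?L" using True by (intro Max_in) auto
  moreover have "l \<le> Max ?L" if "l \<in> ?L" for l using that by (intro Max_ge) auto
  ultimately have *: "label_perm n f k < k" "f (label_perm n f k) = f k"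
    "\<And>l. l < k \<Longrightarrow> f l = f k \<Longrightarrow> l \<le> label_perm n f k"
    unfolding eq by auto
  show ?thesis using pred[OF *(1,2)] *(3) not_le by blast
next
  case False
  let ?L = "{l. l < n \<and> f l = f k}"
  have eq: "label_perm n f k = Max ?L" by (simp only: label_perm_def assms False if_True if_False)
  have "k \<in> ?L" using assms by simp
  then have "Max ?L \<in> ?L" by (intro Max_in) auto
  moreover have le: "l \<le> Max ?L" if "l \<in> ?L" for l using that by (intro Max_ge) auto
  moreover have "k \<le> Max ?L" using le \<open>k \<in> ?L\<close> by blast
  ultimately have *: "k \<le> label_perm n f k" "label_perm n f k < n" "f (label_perm n f k) = f k"
    "\<And>l. l < n \<Longrightarrow> f l = f k \<Longrightarrow> l \<le> label_perm n f k"
    unfolding eq by auto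
  show ?thesis using wrap[OF *(1-3)] *(4) False not_le by blast
qed

text \<open>The two alternatives determine the value, so images can be found by checking order
  conditions instead of evaluating \<open>Max\<close>.\<close>

lemma label_perm_eqI:
  assumes "k < n" "f m = f k" "m < n"
    and "(m < k \<and> (\<forall>l. m < l \<and> l < k \<longrightarrow> f l \<noteq> f k)) \<or> (\<forall>l<n. f l = f k \<longrightarrow> k \<le> l \<and> l \<le> m)"
  shows "label_perm n f k = m"
  using assms(1)
proof (cases rule: label_perm_cases[where f = f])
  case pred
  then show ?thesis using assms by (metis less_trans linorder_neqE_nat not_less)
next
  case wrap
  then show ?thesis using assms by (metis antisym less_trans not_less)
qed

section \<open>Products of block cycles as label permutations\<close>

lemma cycle_of_list_nth:
  assumes "distinct cs" "k < length cs"
  shows "cycle_of_list cs (cs ! k) = cs ! (Suc k mod length cs)"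
proof -
  have "map (cycle_of_list cs) cs = rotate1 cs"
    using cyclic_rotation[OF assms(1), of 1] by simp
  then have "cycle_of_list cs (cs ! k) = rotate1 cs ! k"
    using assms(2) by (metis nth_map)
  then show ?thesis using assms(2) by (simp add: nth_rotate1)
qed

lemma block_cycle_label_perm:
  assumes B: "B = {l. l < n \<and> f l = f k}" and k: "k < n"
  shows "block_cycle B k = label_perm n f k"
proof -
  define s where "s = sorted_list_of_set B"
  have fin: "finite B" using B by simp
  have s: "set s = B" "sorted_wrt (<) s" "distinct s" using fin by (simp_all add: s_def)
  have kB: "k \<in> B" using B k by simp
  then obtain t where t: "t < length s" "s ! t = k" using s by (metis in_set_conv_nth)
  have mono: "s ! a < s ! b \<longleftrightarrow> a < b" if "a < length s" "b < length s" for a b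
    using s(2) that by (metis linorder_neqE_nat order_less_asym sorted_wrt_iff_nth_less less_irrefl)
  \<comment> \<open>Position of \<open>k\<close> in the reversed list. Its cyclic successor there is
    entry \<open>t - 1\<close> of \<open>s\<close>, or the last entry of \<open>s\<close> if
    \<open>t = 0\<close>.\<close>
  let ?u = "length s - 1 - t"
  have rev: "rev s ! ?u = k" using t by (simp add: rev_nth)
  have bc: "block_cycle B k = rev s ! (Suc ?u mod length s)"
    using cycle_of_list_nth[of "rev s" ?u] s(3) t rev by (simp add: block_cycle_def s_def)
  have memB: "\<exists>a<length s. s ! a = l" if "l < n" "f l = f k" for l
    using that s(1) B by (metis (mono_tags, lifting) in_set_conv_nth mem_Collect_eq)
  have inB: "s ! a < n \<and> f (s ! a) = f k" if "a < length s" for a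
    using that s(1) B nth_mem by blast
  show ?thesis
  proof (cases "t = 0")
    case True
    then have "Suc ?u mod length s = 0" using t by (cases "length s") auto
    moreover have "rev s ! 0 = s ! (length s - 1)" using t rev_nth[of 0 s] by fastforce
    ultimately have bc': "block_cycle B k = s ! (length s - 1)" using bc by simp
    have "k \<le> l \<and> l \<le> s ! (length s - 1)" if l: "l < n" "f l = f k" for l
    proof -
      obtain a where a: "a < length s" "s ! a = l" using memB[OF l] by metis
      have "\<not> s ! a < s ! t" "\<not> s ! (length s - 1) < s ! a"
        using a(1) t(1) True mono[of a t] mono[of "length s - 1" a] by linarith+
      then show ?thesis using a t by simp
    qed
    then have "label_perm n f k = s ! (length s - 1)"
      using inB[of "length s - 1"] t k by (intro label_perm_eqI) auto
    then show ?thesis using bc' by simp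
  next
    case False
    then have "Suc ?u mod length s = Suc ?u" using t by simp
    then have bc': "block_cycle B k = s ! (t - 1)"
      using bc t False rev_nth[of "Suc ?u" s] by (simp add: Suc_diff_Suc)
    have "f l \<noteq> f k" if l: "s ! (t - 1) < l" "l < k" for l
    proof
      assume "f l = f k"
      then obtain a where a: "a < length s" "s ! a = l" using memB l k by (meson less_trans)
      then have "t - 1 < a" "a < t" using mono l t by (metis less_imp_diff_less)+
      then show False by simp
    qed
    moreover have "s ! (t - 1) < k" using mono[of "t - 1" t] t False by simp
    ultimately have "label_perm n f k = s ! (t - 1)"
      using inB[of "t - 1"] t k by (intro label_perm_eqI) auto
    then show ?thesis using bc' by simp
  qed
qed

text \<open>The cycle of a block preserves that block and fixes everything outside it, so only the
  cycle of the block containing \<open>k\<close> acts on \<open>k\<close>, wherever it stands in the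
  list.\<close>

lemma foldr_comp_disjoint:
  assumes "distinct Bs" "disjoint (set Bs)" "\<And>B. B \<in> set Bs \<Longrightarrow> finite B"
  shows "foldr (\<circ>) (map block_cycle Bs) id k =
    (if \<exists>B\<in>set Bs. k \<in> B then block_cycle (THE B. B \<in> set Bs \<and> k \<in> B) k else k)"
  using assms
proof (induction Bs)
  case Nil
  then show ?case by simp
next
  case (Cons B Bs)
  have disj: "disjoint (set Bs)" using Cons.prems(2) by (auto simp: disjoint_def)
  have uniq: "C = D" if "C \<in> set (B # Bs)" "D \<in> set (B # Bs)" "x \<in> C" "x \<in> D" for C D x
    using that disjointD[OF Cons.prems(2), of C D] by blast
  have bij: "block_cycle B permutes B"
    using cycle_permutes[of "rev (sorted_list_of_set B)"] Cons.prems(3) by (simp add: block_cycle_def)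
  show ?case
  proof (cases "\<exists>C\<in>set Bs. k \<in> C")
    case True
    then obtain C where C: "C \<in> set Bs" "k \<in> C" by blast
    have the1: "(THE D. D \<in> set Bs \<and> k \<in> D) = C" "(THE D. D \<in> set (B # Bs) \<and> k \<in> D) = C"
      using C uniq by (auto intro!: the_equality)
    have "block_cycle C k \<in> C"
      using cycle_permutes[of "rev (sorted_list_of_set C)"] Cons.prems(3)[of C] C
      by (simp add: block_cycle_def permutes_in_image)
    moreover have "B \<noteq> C" using C Cons.prems(1) by auto
    ultimately have "block_cycle C k \<notin> B" using uniq C by (metis list.set_intros)
    then have "block_cycle B (block_cycle C k) = block_cycle C k"
      using bij by (simp add: permutes_not_in)
    moreover have "foldr (\<circ>) (map block_cycle Bs) id k = block_cycle C k"
      using Cons.IH Cons.prems disj True the1(1) by (simp del: id_apply comp_apply)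
    moreover have "foldr (\<circ>) (map block_cycle (B # Bs)) id k
      = block_cycle B (foldr (\<circ>) (map block_cycle Bs) id k)" by simp
    moreover have "\<exists>D\<in>set (B # Bs). k \<in> D" by (rule bexI[of _ C]) (use C in auto)
    ultimately show ?thesis by (simp only: the1 if_True)
  next
    case False
    then have "foldr (\<circ>) (map block_cycle Bs) id k = k"
      using Cons.IH Cons.prems disj by (simp del: id_apply comp_apply)
    then have eq: "foldr (\<circ>) (map block_cycle (B # Bs)) id k = block_cycle B k" by simp
    show ?thesis
    proof (cases "k \<in> B")
      case True
      then have "(THE D. D \<in> set (B # Bs) \<and> k \<in> D) = B"
        using uniq by (intro the_equality) auto
      then show ?thesis using eq True by (simp del: id_apply comp_apply foldr.simps list.map)
    next
      case kB: False
      then have "block_cycle B k = k" "\<not> (\<exists>D\<in>set (B # Bs). k \<in> D)"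
        using bij False by (auto simp: permutes_not_in)
      then show ?thesis using eq by (simp only: if_False)
    qed
  qed
qed

lemma foldr_block_cycle_label_perm:
  assumes Bs: "distinct Bs" "partition_on {..<n} (set Bs)"
    and f: "\<And>B k l. B \<in> set Bs \<Longrightarrow> k \<in> B \<Longrightarrow> l \<in> B \<longleftrightarrow> l < n \<and> f l = f k"
  shows "foldr (\<circ>) (map block_cycle Bs) id = label_perm n f"
proof
  fix k
  have disj: "disjoint (set Bs)" and un: "\<Union>(set Bs) = {..<n}"
    using Bs(2) by (auto simp: partition_on_def)
  have fin: "finite B" if "B \<in> set Bs" for B
    using that un by (metis Union_upper finite_lessThan finite_subset)
  note eq = foldr_comp_disjoint[OF Bs(1) disj fin, of k]
  show "foldr (\<circ>) (map block_cycle Bs) id k = label_perm n f k"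
  proof (cases "k < n")
    case True
    then obtain B where B: "B \<in> set Bs" "k \<in> B" using un by (metis UnionE lessThan_iff)
    have "(THE D. D \<in> set Bs \<and> k \<in> D) = B"
      using B disj by (intro the_equality) (auto simp: disjoint_def pairwise_def disjnt_iff)
    moreover have "B = {l. l < n \<and> f l = f k}" using f[OF B] by auto
    ultimately show ?thesis using eq B True block_cycle_label_perm by (metis (mono_tags, lifting))
  next
    case False
    then have "\<not> (\<exists>B\<in>set Bs. k \<in> B)" using un by (metis UnionI lessThan_iff)
    then show ?thesis using eq False by (simp add: label_perm_outside)
  qed
qed

lemma NC_label_permI:
  assumes "nc_label n f"
  shows "label_perm n f \<in> NC n"
proof -
  define P where "P = (\<lambda>k. {l. l < n \<and> f l = f k}) ` {..<n}"
  obtain Bs where Bs: "set Bs = P" "distinct Bs"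
    using finite_distinct_list[of P] by (auto simp: P_def)
  have part: "partition_on {..<n} P"
    by (rule partition_onI) (auto simp: P_def disjnt_iff)
  have nc: "noncrossing P"
    unfolding noncrossing_def
  proof (intro ballI impI)
    fix B C a b c d
    assume *: "B \<in> P" "C \<in> P" "a \<in> B" "b \<in> C" "c \<in> B" "d \<in> C" "a < b \<and> b < c \<and> c < d"
    obtain k l where kl: "B = {x. x < n \<and> f x = f k}" "C = {x. x < n \<and> f x = f l}"
      using * by (auto simp: P_def)
    have "f a = f k" "f c = f k" "f b = f l" "f d = f l" "d < n"
      using *(3-6) kl by auto
    moreover from this have "f a = f b"
      using assms[unfolded nc_label_def, rule_format, of a b c d] *(7) by simp
    ultimately show "B = C" unfolding kl by simp
  qed
  have "foldr (\<circ>) (map block_cycle Bs) id = label_perm n f"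
    using Bs part by (intro foldr_block_cycle_label_perm) (auto simp: P_def)
  then show ?thesis unfolding NC_def using Bs part nc by (smt (verit, best) mem_Collect_eq)
qed

text \<open>Each point is labelled by the block that contains it, hence the label type
  \<open>nat set\<close>.\<close>

lemma NC_label_permE:
  assumes "w \<in> NC n"
  obtains f :: "nat \<Rightarrow> nat set" where "nc_label n f" "w = label_perm n f"
proof -
  obtain Bs where Bs: "distinct Bs" "partition_on {..<n} (set Bs)" "noncrossing (set Bs)"
    "w = foldr (\<circ>) (map block_cycle Bs) id"
    using assms by (auto simp: NC_def)
  have un: "\<Union>(set Bs) = {..<n}" and disj: "disjoint (set Bs)"
    using Bs(2) by (auto simp: partition_on_def)
  define f where "f k = (THE B. B \<in> set Bs \<and> k \<in> B)" for k
  have f_eq: "f k = B" if "B \<in> set Bs" "k \<in> B" for B k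
    unfolding f_def using that disj
    by (intro the_equality) (auto simp: disjoint_def pairwise_def disjnt_iff)
  have f_in: "f k \<in> set Bs" "k \<in> f k" if k: "k < n" for k
  proof -
    obtain B where "B \<in> set Bs" "k \<in> B" using k un by (metis UnionE lessThan_iff)
    then show "f k \<in> set Bs" "k \<in> f k" using f_eq by auto
  qed
  have "nc_label n f"
    unfolding nc_label_def
  proof (intro allI impI, elim conjE)
    fix a b c d
    assume *: "a < b" "b < c" "c < d" "d < n" "f a = f c" "f b = f d"
    have "a \<in> f a" "b \<in> f b" "c \<in> f a" "d \<in> f b" "f a \<in> set Bs" "f b \<in> set Bs"
      using f_in[of a] f_in[of b] f_in[of c] f_in[of d] *(1-4) unfolding *(5,6)[symmetric]
      by linarith+
    then show "f a = f b" using Bs(3) * unfolding noncrossing_def by blast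
  qed
  moreover have "w = label_perm n f"
    unfolding Bs(4)
  proof (rule foldr_block_cycle_label_perm[OF Bs(1,2)])
    fix B k l assume B: "B \<in> set Bs" "k \<in> B"
    show "l \<in> B \<longleftrightarrow> l < n \<and> f l = f k"
      using f_eq[OF B] f_eq[OF B(1)] f_in[of l] B un by (metis UnionI lessThan_iff)
  qed
  ultimately show ?thesis using that by blast
qed

lemma NC_permutes:
  assumes "w \<in> NC n"
  shows "w permutes {..<n}"
proof -
  obtain f :: "nat \<Rightarrow> nat set" where w: "w = label_perm n f"
    using NC_label_permE[OF assms] by blast
  have lt: "w k < n" if "k < n" for k
    unfolding w using that by (cases rule: label_perm_cases[where f = f]) (use that in auto)
  have "inj_on w {..<n}"
  proof (rule inj_onI)
    fix k l assume kl: "k \<in> {..<n}" "l \<in> {..<n}" and eq: "w k = w l"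
    have k: "k < n" and l: "l < n" using kl by auto
    show "k = l"
      using k
    proof (cases rule: label_perm_cases[where f = f])
      case kp: pred
      from l show ?thesis
      proof (cases rule: label_perm_cases[where f = f])
        case pred
        then show ?thesis using kp eq w by (metis linorder_neqE_nat)
      next
        case wrap
        then show ?thesis using kp eq w k by (metis not_le)
      qed
    next
      case kw: wrap
      from l show ?thesis
      proof (cases rule: label_perm_cases[where f = f])
        case pred
        then show ?thesis using kw eq w l by (metis not_le)
      next
        case wrap
        then show ?thesis using kw eq w k l by (metis antisym)
      qed
    qed
  qed
  moreover have "w ` {..<n} \<subseteq> {..<n}" using lt by auto
  ultimately have "bij_betw w {..<n} {..<n}"
    by (simp add: endo_inj_surj inj_on_imp_bij_betw bij_betw_def)
  moreover have "w k = k" if "k \<notin> {..<n}" for k using that w by (simp add: label_perm_outside)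
  ultimately show ?thesis using bij_imp_permutes by blast
qed

section \<open>Arcs of noncrossing permutations\<close>

lemma NC_arcs_noncrossing:
  assumes "w \<in> NC n" "max k (w k) < max l (w l)"
    "min k (w k) < min l (w l)" "min l (w l) < max k (w k)"
  shows False
proof -
  obtain f :: "nat \<Rightarrow> nat set" where f: "nc_label n f" and w: "w = label_perm n f"
    using NC_label_permE[OF assms(1)] by blast
  have k: "k < n" using assms w label_perm_outside[of n k f] by (cases "k < n") auto
  have l: "l < n" using assms w label_perm_outside[of n l f] by (cases "l < n") auto
  have fk: "f (w k) = f k" "w k < n" unfolding w using k by (cases rule: label_perm_cases[where f = f]; auto)+
  have fl: "f (w l) = f l" "w l < n" unfolding w using l by (cases rule: label_perm_cases[where f = f]; auto)+
  \<comment> \<open>The endpoints of the two arcs alternate, so both arcs lie in one block.\<close>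
  have "f (min k (w k)) = f (min l (w l))"
    using f[unfolded nc_label_def, rule_format, of "min k (w k)" "min l (w l)" "max k (w k)" "max l (w l)"]
      assms fk fl k l by (auto simp: min_def max_def split: if_splits)
  then have fkl: "f k = f l" using fk fl by (simp add: min_def split: if_splits)
  \<comment> \<open>An arc between neighbours of the block has no element of the block strictly
    inside; an arc between its extremes has none outside. Either excludes the crossing.\<close>
  show False
    using k
  proof (cases rule: label_perm_cases[where f = f])
    case pred
    then show ?thesis using assms fkl fl by (auto simp: w min_def max_def split: if_splits)
  next
    case wrap
    have "l \<le> w k" "w l \<le> w k" "k \<le> w k"
      using wrap(1) wrap(4)[of l] wrap(4)[of "w l"] l fl fkl by (simp_all add: w)
    then show ?thesis using assms(2) by simp
  qed
qed

text \<open>\<open>l < w l\<close> happens only at the minimum of a nontrivial block, and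
  \<open>w l\<close> is then its maximum. This settles configurations where two arcs share an
  endpoint, to which the strict inequalities of \<open>NC_arcs_noncrossing\<close> do not
  apply.\<close>

lemma NC_wrap:
  assumes "w \<in> NC n" "l < w l"
  shows "w (w l) < w l" "l \<le> w (w l)" "w k = l \<Longrightarrow> k \<le> w l"
proof -
  obtain f :: "nat \<Rightarrow> nat set" where f: "nc_label n f" and w: "w = label_perm n f"
    using NC_label_permE[OF assms(1)] by blast
  have lt: "w x < n" "f (w x) = f x" if "x < n" for x
    unfolding w using that by (cases rule: label_perm_cases[where f = f]; auto)+
  have l: "l < n" using assms w label_perm_outside[of n l f] by (cases "l < n") auto
  then have max: "\<And>x. x < n \<Longrightarrow> f x = f l \<Longrightarrow> l \<le> x \<and> x \<le> w l"
    using assms(2) unfolding w by (cases rule: label_perm_cases[where f = f]) auto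
  note wl = lt[OF l]
  show "l \<le> w (w l)" using max[of "w (w l)"] lt[OF wl(1)] wl(2) by simp
  show "k \<le> w l" if "w k = l"
    using max[of k] lt[of k] that l label_perm_outside[of n k f] w by (cases "k < n") auto
  from wl(1) show "w (w l) < w l"
  proof (cases rule: label_perm_cases[where f = f])
    case pred
    then show ?thesis by (simp add: w)
  next
    case wrap
    then show ?thesis using wrap(4)[OF l wl(2)[symmetric]] assms(2) by simp
  qed
qed

text \<open>Left multiplication by the transposition of two elements \<open>i < j\<close> of a block
  cuts off the part of the block in the interval \<open>(i, j]\<close>. \<open>g\<close> may be any
  labelling of the refined partition, so that one lemma serves both for splitting a block and, read
  backwards, for merging two.\<close>

lemma label_perm_split:
  assumes nc: "nc_label n f" and ij: "i < j" "j < n" "f i = f j"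
    and g: "\<And>k l. k < n \<Longrightarrow> l < n \<Longrightarrow> g k = g l \<longleftrightarrow>
      f k = f l \<and> (f k = f j \<longrightarrow> (i < k \<and> k \<le> j \<longleftrightarrow> i < l \<and> l \<le> j))"
  shows "nc_label n g" "label_perm n g = Transposition.transpose i j \<circ> label_perm n f"
proof -
  show "nc_label n g"
    unfolding nc_label_def
  proof (intro allI impI, elim conjE)
    fix a b c d
    assume *: "a < b" "b < c" "c < d" "d < n" "g a = g c" "g b = g d"
    then have "f a = f c" "f b = f d" using g by (meson less_trans)+
    then have "f a = f b" using nc * unfolding nc_label_def by blast
    \<comment> \<open>Convexity of \<open>(i, j]\<close>: two alternating pairs cannot lie on
      different sides of the cut.\<close>
    then show "g a = g b" using g[of a c] g[of b d] g[of a b] * by (auto; linarith)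
  qed
  show "label_perm n g = Transposition.transpose i j \<circ> label_perm n f"
  proof
    fix k
    show "label_perm n g k = (Transposition.transpose i j \<circ> label_perm n f) k"
    proof (cases "k < n")
      case False
      then show ?thesis using ij by (simp add: label_perm_outside transpose_def)
    next
      case k: True
      let ?m = "label_perm n f k"
      have m: "f ?m = f k" "?m < n"
        using k by (cases rule: label_perm_cases[where f = f]; auto)+
      let ?t = "Transposition.transpose i j ?m"
      have t: "f ?t = f k" "?t < n" using m ij by (auto simp: transpose_def)
      show ?thesis
        unfolding comp_apply
      proof (rule label_perm_eqI[OF k])
        show "?t < n" by fact
        from k show "g ?t = g k"
        proof (cases rule: label_perm_cases[where f = f])
          case pred
          have "i < ?t \<and> ?t \<le> j \<longleftrightarrow> i < k \<and> k \<le> j" if fk: "f k = f j"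
          proof -
            have "\<not> (?m < i \<and> i < k)" "\<not> (?m < j \<and> j < k)"
              using pred(3)[of i] pred(3)[of j] fk ij(3) by auto
            then show ?thesis using pred(1) ij(1) by (auto simp: transpose_def)
          qed
          then show ?thesis using g[of ?t k] t k by auto
        next
          case wrap
          have "i < ?t \<and> ?t \<le> j \<longleftrightarrow> i < k \<and> k \<le> j" if fk: "f k = f j"
          proof -
            have "k \<le> i" "j \<le> ?m"
              using wrap(4)[of i] wrap(4)[of j] fk ij by auto
            then show ?thesis using ij(1) by (auto simp: transpose_def)
          qed
          then show ?thesis using g[of ?t k] t k by auto
        qed
        have gk: "g l = g k \<longleftrightarrow> f l = f k \<and> (f k = f j \<longrightarrow> (i < l \<and> l \<le> j \<longleftrightarrow> i < k \<and> k \<le> j))"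
          if "l < n" for l using g[of l k] k that by auto
        from k show "?t < k \<and> (\<forall>l. ?t < l \<and> l < k \<longrightarrow> g l \<noteq> g k) \<or>
          (\<forall>l<n. g l = g k \<longrightarrow> k \<le> l \<and> l \<le> ?t)"
        proof (cases rule: label_perm_cases[where f = f])
          case pred
          \<comment> \<open>If the old image is \<open>i\<close>, then \<open>k\<close> is the
            minimum of the cut-off part and goes to its maximum \<open>j\<close>. If it is
            \<open>j\<close>, then \<open>k\<close> is the next element above \<open>j\<close> and
            now steps down to \<open>i\<close>. Other images are unchanged.\<close>
          consider "?m = i" | "?m = j" | "?m \<noteq> i" "?m \<noteq> j" by blast
          then show ?thesis
          proof cases
            case 1
            then have "k \<le> j" using pred(1) pred(3)[of j] ij m by (metis not_le_imp_less)
            then have "k \<le> l \<and> l \<le> j" if "l < n" "g l = g k" for l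
              using gk[OF that(1)] that pred 1 ij by (metis not_le_imp_less)
            then show ?thesis using 1 by simp
          next
            case 2
            then have jk: "j < k" "f k = f j" using pred by auto
            have "g l \<noteq> g k" if l: "i < l" "l < k" for l
            proof (cases "l \<le> j")
              case True
              then show ?thesis using gk[of l] jk l k by auto
            next
              case False
              then show ?thesis using gk[of l] pred(3)[of l] 2 l k by auto
            qed
            then show ?thesis using 2 pred ij by simp
          next
            case 3
            then show ?thesis using gk pred k by (auto simp: transpose_def)
          qed
        next
          case wrap
          show ?thesis
          proof (cases "?m = j")
            case True
            then have "k \<le> i" using wrap(3) wrap(4)[of i] True ij by simp
            then have "k \<le> l \<and> l \<le> i" if "l < n" "g l = g k" for l
              using gk[OF that(1)] that(2) wrap(4)[OF that(1)] wrap(3) True ij(1)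
              by (metis not_le)
            then show ?thesis using True by simp
          next
            case False
            moreover have "?m \<noteq> i" using wrap(3) wrap(4)[of j] ij by (metis not_le)
            ultimately show ?thesis using gk wrap by (auto simp: transpose_def)
          qed
        qed
      qed
    qed
  qed
qed

section \<open>Levels\<close>

text \<open>Counts the points of \<open>[r] - A\<close> up to \<open>k\<close>, respectively those
  of \<open>A\<close> from \<open>k\<close> on. The parity records the side of \<open>r\<close>: odd
  below \<open>r\<close>, even from \<open>r\<close> on. Hence close levels on the same side are
  equal.\<close>

definition lev :: "nat \<Rightarrow> nat set \<Rightarrow> nat \<Rightarrow> nat" where
  "lev r A k = (if k < r then 2 * card ({..k} - A) + 1 else 2 * card (A \<inter> {k..}))"

abbreviation close_levels :: "nat \<Rightarrow> nat set \<Rightarrow> nat \<Rightarrow> nat \<Rightarrow> bool" where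
  "close_levels r A i j \<equiv> lev r A i \<le> lev r A j + 1 \<and> lev r A j \<le> lev r A i + 1"

lemma lev_mono: "k \<le> l \<Longrightarrow> l < r \<Longrightarrow> lev r A k \<le> lev r A l"
  by (auto simp: lev_def intro!: card_mono)

lemma lev_antimono: "finite A \<Longrightarrow> r \<le> k \<Longrightarrow> k \<le> l \<Longrightarrow> lev r A l \<le> lev r A k"
  by (auto simp: lev_def intro!: card_mono)

text \<open>Flow balance of \<open>f\<close> across \<open>T\<close>: the points that leave and
  those that enter account for the change. Stated with sums because subtraction on
  \<open>nat\<close> truncates.\<close>

lemma card_image_Int:
  assumes "finite K" "inj_on f K"
  shows "card (f ` K \<inter> T) + card {k\<in>K. k \<in> T \<and> f k \<notin> T} =
    card (K \<inter> T) + card {k\<in>K. k \<notin> T \<and> f k \<in> T}"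
proof -
  have "card (f ` K \<inter> T) = card {k\<in>K. f k \<in> T}"
  proof -
    have "f ` K \<inter> T = f ` {k\<in>K. f k \<in> T}" by auto
    then show ?thesis using assms by (metis (no_types, lifting) card_image inj_on_subset mem_Collect_eq subsetI)
  qed
  moreover have "card {k\<in>K. f k \<in> T} = card {k\<in>K. k \<in> T \<and> f k \<in> T} + card {k\<in>K. k \<notin> T \<and> f k \<in> T}"
    using assms by (subst card_Un_disjoint[symmetric]) (auto intro!: arg_cong[where f = card])
  moreover have "card (K \<inter> T) = card {k\<in>K. k \<in> T \<and> f k \<in> T} + card {k\<in>K. k \<in> T \<and> f k \<notin> T}"
    using assms by (subst card_Un_disjoint[symmetric]) (auto intro!: arg_cong[where f = card])
  ultimately show ?thesis by simp
qed

text \<open>A noncrossing inversion: the values \<open>i < j\<close> of \<open>w\<close> stand at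
  the positions \<open>a > b\<close>, and exchanging them stays in \<open>NC n\<close>. The proofs
  play the arcs of \<open>w\<close> off against those of \<open>u\<close>.\<close>

locale kreweras_pair =
  fixes n r :: nat and w u :: "nat \<Rightarrow> nat" and i j a b :: nat
  assumes w: "w \<in> NC n" and u: "u \<in> NC n"
    and u_def: "u = Transposition.transpose i j \<circ> w"
    and ij: "i < j" "j < n" "w a = i" "w b = j" and ba: "b < a"
begin

lemma u_simps: "u a = j" "u b = i" "k \<noteq> a \<Longrightarrow> k \<noteq> b \<Longrightarrow> u k = w k"
proof -
  show "u a = j" "u b = i" using ij by (auto simp: u_def)
  assume "k \<noteq> a" "k \<noteq> b"
  then have "w k \<noteq> i" "w k \<noteq> j"
    using ij permutes_inj[OF NC_permutes[OF w]] by (auto dest: injD)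
  then show "u k = w k" by (simp add: u_def transpose_def)
qed

lemma arcs_w: "max k (w k) < max l (w l) \<Longrightarrow> min k (w k) < min l (w l) \<Longrightarrow> min l (w l) < max k (w k) \<Longrightarrow> False"
  using NC_arcs_noncrossing[OF w] .

lemma arcs_u: "max k (u k) < max l (u l) \<Longrightarrow> min k (u k) < min l (u l) \<Longrightarrow> min l (u l) < max k (u k) \<Longrightarrow> False"
  using NC_arcs_noncrossing[OF u] .

text \<open>Otherwise \<open>i < j < b < a\<close>, and the arcs of \<open>u\<close> from
  \<open>b\<close> to \<open>i\<close> and from \<open>a\<close> to \<open>j\<close> cross.\<close>

lemma b_le: "b \<le> j"
proof (rule ccontr)
  assume "\<not> b \<le> j"
  then show False using arcs_u[of b a] ij ba by (simp add: u_simps)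
qed

text \<open>Otherwise \<open>b < a < i < j\<close>, and the same two arcs of \<open>u\<close> cross;
  the boundary case \<open>a = i\<close> contradicts \<open>NC_wrap\<close>, as \<open>u\<close>
  would ascend twice.\<close>

lemma i_less: "i < a"
proof (rule ccontr)
  assume "\<not> i < a"
  moreover have "a \<noteq> i" using NC_wrap(1)[OF u, of b] ij ba by (auto simp: u_simps)
  ultimately have "a < i" by simp
  then show False using arcs_u[of b a] ij ba b_le by (simp add: u_simps)
qed

text \<open>If \<open>i\<close> and \<open>j\<close> lie on the same side of \<open>r\<close>, a
  point separating their levels would carry an arc that crosses one at \<open>a\<close> or
  \<open>b\<close>. If they lie on different sides, a flow count bounds the difference of the levels
  by one.\<close>

lemma close:
  assumes r: "b < r" "r \<le> a" "r \<le> n"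
  shows "close_levels r (w ` {..<r}) i j"
proof -
  define A where "A = w ` {..<r}"
  have inj: "w k = w l \<longleftrightarrow> k = l" for k l using permutes_inj[OF NC_permutes[OF w]] by (auto dest: injD)
  have surj: "\<exists>k. w k = x" for x using permutes_surj[OF NC_permutes[OF w]] by (metis surjD)
  have memA: "w k \<in> A \<longleftrightarrow> k < r" for k using inj by (auto simp: A_def)
  have fin: "finite A" by (simp add: A_def)
  consider (lo) "j < r" | (hi) "r \<le> i" | (mid) "i < r" "r \<le> j" by linarith
  then have "close_levels r A i j"
  proof cases
    case lo
    have "x \<in> A" if x: "i < x" "x \<le> j" for x
    proof (rule ccontr)
      assume "x \<notin> A"
      obtain c where c: "w c = x" using surj by blast
      have "r \<le> c" using \<open>x \<notin> A\<close> memA c by (metis not_le)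
      moreover have "x \<noteq> j" using \<open>x \<notin> A\<close> memA r ij by metis
      moreover have "c \<noteq> a" "c \<noteq> b" using c ij x inj \<open>x \<noteq> j\<close> by auto
      ultimately have "u c = x" "x < j" "r \<le> c" using c x u_simps by auto
      show False
      proof (cases "c < a")
        case True
        then show ?thesis using arcs_u[of c a] u_simps lo x \<open>u c = x\<close> \<open>x < j\<close> \<open>r \<le> c\<close> r by simp
      next
        case False
        then show ?thesis using arcs_w[of a c] ij c x lo r \<open>c \<noteq> a\<close> \<open>r \<le> c\<close> by simp
      qed
    qed
    then have "x \<in> {..i} - A \<longleftrightarrow> x \<in> {..j} - A" for x using ij by (cases "x \<le> i") auto
    then have "{..i} - A = {..j} - A" by blast
    then show ?thesis using lo ij by (simp add: lev_def)
  next
    case hi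
    have "z \<notin> A" if z: "i \<le> z" "z < j" for z
    proof
      assume "z \<in> A"
      then obtain e where e: "e < r" "w e = z" by (auto simp: A_def)
      have ea: "e \<noteq> a" "e \<noteq> b" using e ij z r by auto
      have "u e = z" "z \<noteq> i" using u_simps(3)[OF ea] e ij inj[of e a] ea by auto
      show False
      proof (cases "e < b")
        case True
        then show ?thesis using arcs_w[of e b] ij e z hi r by simp
      next
        case False
        then show ?thesis using arcs_u[of b e] u_simps e z hi r \<open>u e = z\<close> \<open>z \<noteq> i\<close> \<open>e \<noteq> b\<close> by simp
      qed
    qed
    moreover have "j \<in> A" using ij r memA by metis
    ultimately have "x \<in> A \<inter> {i..} \<longleftrightarrow> x \<in> A \<inter> {j..}" for x using ij by (cases "x < j") auto
    then have "A \<inter> {i..} = A \<inter> {j..}" by blast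
    then show ?thesis using hi ij by (simp add: lev_def)
  next
    case mid
    \<comment> \<open>Among the positions below \<open>r\<close>, none leaves \<open>T\<close> and
      at most \<open>b\<close> enters it, so \<open>A\<close> has \<open>0\<close> or
      \<open>1\<close> more points in \<open>T\<close> than \<open>[r]\<close> has. Since
      \<open>[r]\<close> meets \<open>T\<close> in \<open>{..i}\<close>, this compares the missing
      points up to \<open>i\<close> with the points of \<open>A\<close> from \<open>j\<close>
      on.\<close>
    define T where "T = {..i} \<union> {j..}"
    let ?in = "{k\<in>{..<r}. k \<notin> T \<and> w k \<in> T}" and ?out = "{k\<in>{..<r}. k \<in> T \<and> w k \<notin> T}"
    \<comment> \<open>The arcs of \<open>w\<close> at \<open>a\<close> and \<open>b\<close> do not
      cross, which makes \<open>b \<le> i\<close> and \<open>a \<le> j\<close> hold or fail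
      together.\<close>
    consider (out) "b \<le> i" "a \<le> j" | (nest) "i < b" "j < a"
    proof (cases "b \<le> i")
      case True
      have "a \<le> j"
      proof (rule ccontr)
        assume "\<not> a \<le> j"
        then show False
          using arcs_w[of b a] NC_wrap(3)[OF w, of b a] ij True b_le i_less mid by (cases "b = i") simp_all
      qed
      then show ?thesis using out True by blast
    next
      case False
      have "a \<noteq> j" using NC_wrap(2)[OF w, of b] ij r mid False by auto
      moreover have "\<not> a < j" using arcs_w[of a b] ij r mid False i_less by auto
      ultimately show ?thesis using nest False by simp
    qed
    note cs = this
    have eq: "card (A \<inter> T) + card ?out = card ({..<r} \<inter> T) + card ?in"
      using card_image_Int[of "{..<r}" w T] inj by (auto simp: inj_on_def A_def)
    \<comment> \<open>An arc from \<open>{..i}\<close> to a value strictly between \<open>i\<close>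
      and \<open>j\<close> would cross an arc at \<open>a\<close> or \<open>b\<close>, or meet it at
      an endpoint against \<open>NC_wrap\<close>.\<close>
    have out: "?out = {}"
    proof -
      have False if k: "k \<le> i" "i < w k" "w k < j" for k
        using cs
      proof cases
        case out
        have "k \<noteq> b" "k \<noteq> a" using k ij i_less by auto
        then have uk: "u k = w k" by (rule u_simps(3)[rotated])
        consider "k < b" | "b < k" "k < i" | "b < i" "k = i" using k \<open>k \<noteq> b\<close> by linarith
        then show False
        proof cases
          case 1
          then show ?thesis using arcs_w[of k b] ij k out b_le by simp
        next
          case 2
          then show ?thesis using arcs_u[of b k] u_simps(2) uk k by simp
        next
          case 3
          then show ?thesis using NC_wrap(1)[OF u, of b] u_simps(2) uk k by simp
        qed
      next
        case nest
        then show False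
          using arcs_w[of k a] NC_wrap(3)[OF w, of i a] ij k i_less by (cases "k = i") simp_all
      qed
      then show ?thesis using mid by (force simp: T_def)
    qed
    have "?in \<subseteq> {b}"
    proof -
      have "k = b" if k: "i < k" "k < r" "w k \<le> i \<or> j \<le> w k" for k
      proof (rule ccontr)
        assume "k \<noteq> b"
        have "k \<noteq> a" using k r by simp
        then have ne: "w k \<noteq> i" "w k \<noteq> j" and uk: "u k = w k"
          using \<open>k \<noteq> b\<close> inj ij u_simps(3) by metis+
        have "\<not> w k < i" using arcs_w[of k a] ij k r by auto
        then have wk: "j < w k" using k ne by linarith
        have "w k \<noteq> a" using NC_wrap(2)[OF w, of k] ij k r wk mid by auto
        moreover have "\<not> a < w k" using arcs_w[of a k] ij k r i_less by auto
        ultimately have "w k < a" by linarith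
        then show False using arcs_u[of k a] u_simps(1) uk wk k r mid by simp
      qed
      then show ?thesis by (auto simp: T_def)
    qed
    then have "card ?in \<le> 1" by (metis card.empty card_mono card.insert finite.emptyI finite.insertI One_nat_def empty_iff)
    moreover have "card (A \<inter> T) = card (A \<inter> {j..}) + card (A \<inter> {..i})"
      using mid fin by (subst card_Un_disjoint[symmetric]) (auto simp: T_def intro!: arg_cong[where f = card])
    moreover have "card ({..<r} \<inter> T) = card {..i}"
      using mid by (intro arg_cong[where f = card]) (auto simp: T_def)
    moreover have "card {..i} = card ({..i} - A) + card (A \<inter> {..i})"
      using card_Int_Diff[of "{..i}" A] by (simp add: Int_commute)
    moreover have "card ?out = 0" by (simp only: out card.empty)
    ultimately have "card ({..i} - A) \<le> card (A \<inter> {j..})"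
      "card (A \<inter> {j..}) \<le> card ({..i} - A) + 1" using eq by linarith+
    then show ?thesis using mid by (simp add: lev_def)
  qed
  then show ?thesis by (simp add: A_def)
qed

end

section \<open>Elements of given rank and unimodal labels\<close>

lemma ex_card_atLeast:
  assumes "finite (Z :: nat set)" "1 \<le> p" "p \<le> card Z"
  shows "\<exists>z\<in>Z. card (Z \<inter> {z..}) = p"
  using assms
proof (induction Z arbitrary: p rule: finite_linorder_max_induct)
  case empty
  then show ?case by simp
next
  case (insert b Z)
  show ?case
  proof (cases "p = 1")
    case True
    have "insert b Z \<inter> {b..} = {b}" using insert.hyps by force
    then have "card (insert b Z \<inter> {b..}) = card {b}" by (rule arg_cong)
    then have "card (insert b Z \<inter> {b..}) = p" unfolding True by simp
    then show ?thesis by blast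
  next
    case False
    have "b \<notin> Z" using insert.hyps by blast
    then have "1 \<le> p - 1" "p - 1 \<le> card Z" using False insert.prems insert.hyps by auto
    then obtain z where z: "z \<in> Z" "card (Z \<inter> {z..}) = p - 1" using insert.IH by blast
    have "insert b Z \<inter> {z..} = insert b (Z \<inter> {z..})" using z insert.hyps by force
    then have "card (insert b Z \<inter> {z..}) = p" using z \<open>b \<notin> Z\<close> insert.hyps insert.prems by simp
    then show ?thesis using z by blast
  qed
qed

lemma ex_card_atMost:
  assumes "finite (X :: nat set)" "1 \<le> p" "p \<le> card X"
  shows "\<exists>x\<in>X. card (X \<inter> {..x}) = p"
  using assms
proof (induction X arbitrary: p rule: finite_linorder_min_induct)
  case empty
  then show ?case by simp
next
  case (insert b X)
  show ?case
  proof (cases "p = 1")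
    case True
    have "insert b X \<inter> {..b} = {b}" using insert.hyps by force
    then have "card (insert b X \<inter> {..b}) = card {b}" by (rule arg_cong)
    then have "card (insert b X \<inter> {..b}) = p" unfolding True by simp
    then show ?thesis by blast
  next
    case False
    have "b \<notin> X" using insert.hyps by blast
    then have "1 \<le> p - 1" "p - 1 \<le> card X" using False insert.prems insert.hyps by auto
    then obtain z where z: "z \<in> X" "card (X \<inter> {..z}) = p - 1" using insert.IH by blast
    have "insert b X \<inter> {..z} = insert b (X \<inter> {..z})" using z insert.hyps by force
    then have "card (insert b X \<inter> {..z}) = p" using z \<open>b \<notin> X\<close> insert.hyps insert.prems by simp
    then show ?thesis using z by blast
  qed
qed

text \<open>\<open>g\<close> rises up to \<open>r\<close> and falls from there on, so for an
  alternating quadruple monotonicity on the two sides squeezes \<open>g a\<close> and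
  \<open>g b\<close> together. Points outside \<open>P\<close> get private labels and form singleton
  blocks.\<close>

lemma nc_label_unimodal:
  fixes g :: "nat \<Rightarrow> nat"
  assumes f: "\<And>k. f k = (if P k then Inl (g k) else Inr k)"
    and lo: "\<And>k l. k \<le> l \<Longrightarrow> l < r \<Longrightarrow> g k \<le> g l"
    and hi: "\<And>k l. r \<le> k \<Longrightarrow> k \<le> l \<Longrightarrow> g l \<le> g k"
  shows "nc_label n f"
  unfolding nc_label_def
proof (intro allI impI, elim conjE)
  fix a b c d
  assume *: "a < b" "b < c" "c < d" "d < n" "f a = f c" "f b = f d"
  have P: "P a" "P b" "P c" "P d" "g a = g c" "g b = g d"
    using * f[of a] f[of b] f[of c] f[of d] by (auto split: if_splits)
  consider "c < r" | "r \<le> b" | "b < r" "r \<le> c" by linarith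
  then have "g a = g b"
  proof cases
    case 1
    then show ?thesis using lo[of a b] lo[of b c] * P by simp
  next
    case 2
    then show ?thesis using hi[of b c] hi[of c d] * P by simp
  next
    case 3
    then show ?thesis using lo[of a b] hi[of c d] * P by simp
  qed
  then show "f a = f b" using f P by simp
qed

section \<open>Levels with respect to a fixed subset\<close>

locale level_subset =
  fixes r n :: nat and A :: "nat set"
  assumes A: "A \<subseteq> {..<n}" "card A = r" and rn: "r \<le> n"
begin

lemma finite_A: "finite A" using A finite_subset by blast

lemma card_missing: "card ({..<r} - A) = card (A - {..<r})"
proof -
  have "card ({..<r} - A) + card (A \<inter> {..<r}) = r"
    using card_Int_Diff[of "{..<r}" A] by (simp add: Int_commute)
  moreover have "card (A - {..<r}) + card (A \<inter> {..<r}) = r"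
    using card_Int_Diff[OF finite_A, of "{..<r}"] A by simp
  ultimately show ?thesis by simp
qed

text \<open>The witness is the point \<open>z\<^sub>p\<close>; in \<open>ex_lev_lo\<close> it is
  \<open>x\<^sub>p\<close>.\<close>

lemma ex_lev_hi:
  assumes "1 \<le> p" "p \<le> card ({..<r} - A)"
  obtains z where "z \<in> A" "r \<le> z" "lev r A z = 2 * p"
proof -
  obtain z where z: "z \<in> A - {..<r}" "card ((A - {..<r}) \<inter> {z..}) = p"
    using ex_card_atLeast[of "A - {..<r}" p] finite_A assms card_missing by auto
  have "(A - {..<r}) \<inter> {z..} = A \<inter> {z..}" using z by auto
  then show ?thesis using z that[of z] by (simp add: lev_def)
qed

lemma ex_lev_lo:
  assumes "1 \<le> p" "p \<le> card ({..<r} - A)"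
  obtains x where "x \<notin> A" "x < r" "lev r A x = 2 * p + 1"
proof -
  obtain x where x: "x \<in> {..<r} - A" "card (({..<r} - A) \<inter> {..x}) = p"
    using ex_card_atMost[of "{..<r} - A" p] assms by auto
  have "({..<r} - A) \<inter> {..x} = {..x} - A" using x by auto
  then show ?thesis using x that[of x] by (simp add: lev_def)
qed

lemma lev_lo_strict: "k < l \<Longrightarrow> l < r \<Longrightarrow> l \<notin> A \<Longrightarrow> lev r A k < lev r A l"
proof -
  assume *: "k < l" "l < r" "l \<notin> A"
  then have "l \<in> {..l} - A" "l \<notin> {..k} - A" "{..k} - A \<subseteq> {..l} - A" by auto
  then have "card ({..k} - A) < card ({..l} - A)" by (intro psubset_card_mono) auto
  then show ?thesis using * by (simp add: lev_def)
qed

lemma lev_hi_strict: "r \<le> k \<Longrightarrow> k < l \<Longrightarrow> k \<in> A \<Longrightarrow> lev r A l < lev r A k"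
proof -
  assume *: "r \<le> k" "k < l" "k \<in> A"
  then have "k \<in> A \<inter> {k..}" "k \<notin> A \<inter> {l..}" "A \<inter> {l..} \<subseteq> A \<inter> {k..}" by auto
  then have "card (A \<inter> {l..}) < card (A \<inter> {k..})" using finite_A by (intro psubset_card_mono) auto
  then show ?thesis using * by (simp add: lev_def)
qed

lemma lev_lo_ge: "k < r \<Longrightarrow> k \<notin> A \<Longrightarrow> 3 \<le> lev r A k"
proof -
  assume "k < r" "k \<notin> A"
  then have "0 < card ({..k} - A)" by (subst card_gt_0_iff) auto
  then show ?thesis using \<open>k < r\<close> by (simp add: lev_def)
qed

lemma lev_hi_pos: "r \<le> k \<Longrightarrow> k \<in> A \<Longrightarrow> 2 \<le> lev r A k"
proof -
  assume "r \<le> k" "k \<in> A"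
  then have "0 < card (A \<inter> {k..})" using finite_A by (subst card_gt_0_iff) auto
  then show ?thesis using \<open>r \<le> k\<close> by (simp add: lev_def)
qed

section \<open>The noncrossing permutation chosen for a subset\<close>

text \<open>The nontrivial blocks of the permutation chosen for \<open>A\<close> consist of \<open>x\<^sub>p\<close> and of all points
  in \<open>(z\<^bsub>p+1\<^esub>, z\<^sub>p]\<close> outside \<open>[r]\<close>, for \<open>p = 1, \<dots>, q\<close>.\<close>

definition in_block :: "nat \<Rightarrow> bool" where
  "in_block k \<longleftrightarrow> (k < r \<and> k \<notin> A) \<or> (r \<le> k \<and> 0 < lev r A k)"

text \<open>Halving identifies the levels \<open>2p\<close> and \<open>2p + 1\<close>, which puts
  \<open>x\<^sub>p\<close> into the block of \<open>z\<^sub>p\<close>.\<close>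

definition block_label :: "nat \<Rightarrow> nat + nat" where
  "block_label k = (if in_block k then Inl (lev r A k div 2) else Inr k)"

definition cell_perm :: "nat \<Rightarrow> nat" where
  "cell_perm = label_perm n block_label"

lemma nc_block_label: "nc_label n block_label"
  by (rule nc_label_unimodal[OF block_label_def, of r])
    (simp_all add: div_le_mono lev_mono lev_antimono[OF finite_A])

lemma cell_perm_NC: "cell_perm \<in> NC n"
  unfolding cell_perm_def by (rule NC_label_permI[OF nc_block_label])

text \<open>Points of \<open>[r]\<close> in \<open>A\<close> are fixed, while
  \<open>x\<^sub>p\<close> is the minimum of its block and goes to the maximum
  \<open>z\<^sub>p\<close>.\<close>

lemma cell_perm_image: "cell_perm ` {..<r} = A"
proof -
  have "cell_perm k \<in> A" if k: "k < r" for k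
  proof (cases "k \<in> A")
    case True
    then have "block_label k = Inr k" using k by (simp add: block_label_def in_block_def)
    then have "l = k" if "block_label l = block_label k" for l
      using that by (auto simp: block_label_def split: if_splits)
    then have "label_perm n block_label k = k" using k rn by (intro label_perm_eqI) auto
    then show ?thesis using True by (simp add: cell_perm_def)
  next
    case False
    define p where "p = card ({..k} - A)"
    have levk: "lev r A k = 2 * p + 1" using k by (simp add: lev_def p_def)
    have "1 \<le> p" using lev_lo_ge[OF k False] levk by simp
    moreover have "p \<le> card ({..<r} - A)" unfolding p_def using k by (intro card_mono) auto
    ultimately obtain z where z: "z \<in> A" "r \<le> z" "lev r A z = 2 * p" by (rule ex_lev_hi)
    have "label_perm n block_label k = z"
    proof (rule label_perm_eqI)
      show "k < n" "z < n" using k rn z A by auto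
      show "block_label z = block_label k"
        using z k False levk \<open>1 \<le> p\<close> by (simp add: block_label_def in_block_def)
      have "k \<le> l \<and> l \<le> z" if l: "l < n" "block_label l = block_label k" for l
      proof -
        have "in_block k" using k False by (simp add: in_block_def)
        then have l': "in_block l" "lev r A l div 2 = p"
          using l levk by (auto simp: block_label_def split: if_splits)
        show ?thesis
        proof (cases "l < r")
          case True
          then have "l \<notin> A" using l' by (simp add: in_block_def)
          moreover have "lev r A l = lev r A k" using True l'(2) levk by (simp add: lev_def)
          ultimately have "l = k" using lev_lo_strict[of l k] lev_lo_strict[of k l] True k False
            by (metis less_irrefl linorder_neqE_nat)
          then show ?thesis using k z by simp
        next
          case lr: False
          then have "lev r A l = 2 * p" using l'(2) by (simp add: lev_def)
          then have "\<not> z < l" using lev_hi_strict[of z l] z by auto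
          then show ?thesis using lr k by simp
        qed
      qed
      then show "(z < k \<and> (\<forall>l. z < l \<and> l < k \<longrightarrow> block_label l \<noteq> block_label k)) \<or>
          (\<forall>l<n. block_label l = block_label k \<longrightarrow> k \<le> l \<and> l \<le> z)" by blast
    qed
    then show ?thesis using z by (simp add: cell_perm_def)
  qed
  then have "cell_perm ` {..<r} \<subseteq> A" by auto
  moreover have "card (cell_perm ` {..<r}) = r"
    using card_image[OF inj_on_subset[OF permutes_inj[OF NC_permutes[OF cell_perm_NC]]]] by auto
  ultimately show ?thesis using A finite_A card_subset_eq by metis
qed

text \<open>One permutation serves all edges from \<open>A\<close> to smaller \<open>i\<close>. If
  \<open>i\<close> and \<open>j\<close> share a block, the block is split. If both lie below
  \<open>r\<close>, the fixed point \<open>j\<close> joins the block of \<open>i\<close>. If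
  \<open>j\<close> is one level above \<open>i\<close> across \<open>r\<close>, their two blocks, of
  consecutive numbers, merge.\<close>

lemma cell_perm_swap_NC:
  assumes ij: "i \<notin> A" "j \<in> A" "i < j" and close: "close_levels r A i j"
  shows "Transposition.transpose i j \<circ> cell_perm \<in> NC n"
proof -
  have jn: "j < n" using ij A by auto
  \<comment> \<open>The transposition either splits a block, or undoes the split of a block of a coarser labelling.\<close>
  have merge: ?thesis if nc: "nc_label n f" and fij: "f i = f j" and
    split: "\<And>k l. k < n \<Longrightarrow> l < n \<Longrightarrow> block_label k = block_label l \<longleftrightarrow>
      f k = f l \<and> (f k = f j \<longrightarrow> (i < k \<and> k \<le> j \<longleftrightarrow> i < l \<and> l \<le> j))" for f :: "nat \<Rightarrow> nat + nat"
  proof -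
    have "cell_perm = Transposition.transpose i j \<circ> label_perm n f"
      unfolding cell_perm_def by (rule label_perm_split(2)[OF nc ij(3) jn fij split])
    then have "Transposition.transpose i j \<circ> cell_perm = label_perm n f"
      by (simp add: fun_eq_iff)
    then show ?thesis using NC_label_permI[OF nc] by simp
  qed
  consider (same) "block_label i = block_label j"
    | (lo) "j < r" "lev r A i = lev r A j"
    | (nest) "i < r" "r \<le> j" "lev r A j = lev r A i + 1"
  proof -
    have jb: "in_block j" if "r \<le> j" using lev_hi_pos[OF that ij(2)] that by (simp add: in_block_def)
    consider "j < r" | "r \<le> i" | "i < r" "r \<le> j" by linarith
    then show ?thesis
    proof cases
      case 1
      then have "lev r A i = lev r A j" using close ij by (simp add: lev_def)
      then show ?thesis using 1 lo by blast
    next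
      case 2
      then have "lev r A i = lev r A j" using close ij by (simp add: lev_def)
      then have "block_label i = block_label j"
        using 2 jb ij by (simp add: block_label_def in_block_def)
      then show ?thesis using same by blast
    next
      case 3
      show ?thesis
      proof (cases "lev r A j = lev r A i + 1")
        case True
        then show ?thesis using 3 nest by blast
      next
        case False
        then have "lev r A i = lev r A j + 1" using close 3 by (simp add: lev_def)
        moreover have "even (lev r A j)" using 3 by (simp add: lev_def)
        ultimately have "lev r A i div 2 = lev r A j div 2" by presburger
        then have "block_label i = block_label j"
          using 3 jb ij by (simp add: block_label_def in_block_def)
        then show ?thesis using same by blast
      qed
    qed
  qed
  then show ?thesis
  proof cases
    case same
    define g where "g k = (block_label k, block_label k = block_label j \<and> i < k \<and> k \<le> j)" for k
    have "nc_label n g" and "label_perm n g = Transposition.transpose i j \<circ> cell_perm"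
      unfolding cell_perm_def
      by (rule label_perm_split[OF nc_block_label ij(3) jn same]; auto simp: g_def)+
    then show ?thesis using NC_label_permI by metis
  next
    case lo
    \<comment> \<open>The labelling after the merge: \<open>j\<close>, a fixed point of
      \<open>cell_perm\<close>, is added to the block of \<open>i\<close>.\<close>
    define f where "f k = (if in_block k \<or> k = j then Inl (lev r A k div 2) else Inr k)" for k
    have ib: "in_block i" "\<not> in_block j" using lo ij by (auto simp: in_block_def)
    have nc: "nc_label n f"
      by (rule nc_label_unimodal[OF f_def, of r])
        (simp_all add: div_le_mono lev_mono lev_antimono[OF finite_A])
    have fij: "f i = f j" using ib lo by (simp add: f_def)
    have out: "\<not> (i < k \<and> k \<le> j)" if k: "k \<noteq> j" "f k = f j" for k
    proof
      assume "i < k \<and> k \<le> j"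
      moreover from this have "in_block k" "k < r" "lev r A k div 2 = lev r A j div 2"
        using k lo by (auto simp: f_def split: if_splits)
      ultimately show False
        using lev_lo_strict[of i k] lev_mono[of k j r A] lo by (auto simp: in_block_def)
    qed
    have eq: "block_label k = block_label l \<longleftrightarrow> f k = f l" if "k \<noteq> j" "l \<noteq> j" for k l
      using that by (simp add: block_label_def f_def)
    have ne: "block_label j \<noteq> block_label k" if "k \<noteq> j" for k
      using that ib by (simp add: block_label_def)
    show ?thesis
    proof (rule merge[OF nc fij])
      fix k l
      show "block_label k = block_label l \<longleftrightarrow>
        f k = f l \<and> (f k = f j \<longrightarrow> (i < k \<and> k \<le> j \<longleftrightarrow> i < l \<and> l \<le> j))"
        using out[of k] out[of l] eq[of k l] ne[of k] ne[of l] ij(3)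
        by (cases "k = j"; cases "l = j") (auto simp: eq_commute)
    qed
  next
    case nest
    define q where "q = card ({..i} - A)"
    have levi: "lev r A i = 2 * q + 1" and levj: "lev r A j = 2 * q + 2"
      using nest by (simp_all add: lev_def q_def)
    \<comment> \<open>\<open>i\<close> is in block \<open>q\<close> and \<open>j\<close> in block
      \<open>q + 1\<close>; the coarser labelling gives both blocks the number
      \<open>q\<close>.\<close>
    define g where "g k = (if lev r A k div 2 = Suc q then q else lev r A k div 2)" for k
    define f where "f k = (if in_block k then Inl (g k) else Inr k)" for k
    have g_mono: "g k \<le> g l" if "lev r A k \<le> lev r A l" for k l
      using div_le_mono[OF that, of 2] by (auto simp: g_def)
    have nc: "nc_label n f"
      by (rule nc_label_unimodal[OF f_def, of r])
        (simp_all add: g_mono lev_mono lev_antimono[OF finite_A])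
    have ib: "in_block i" "in_block j" using nest ij levj by (auto simp: in_block_def)
    have gj: "g i = q" "g j = q" using levi levj by (simp_all add: g_def)
    have fij: "f i = f j" using ib gj by (simp add: f_def)
    \<comment> \<open>Cutting the merged block along \<open>(i, j]\<close> recovers the old block
      \<open>q + 1\<close>.\<close>
    have inside: "i < k \<and> k \<le> j \<longleftrightarrow> lev r A k div 2 = Suc q" if k: "in_block k" "g k = q" for k
    proof (cases "k < r")
      case True
      then have "k \<notin> A" using k by (simp add: in_block_def)
      have "lev r A k = 2 * q + 1 \<or> lev r A k = 2 * q + 3"
        using k(2) True by (auto simp: g_def lev_def split: if_splits)
      moreover have "i < k \<longleftrightarrow> lev r A i < lev r A k"
        using lev_lo_strict[of i k] lev_mono[of k i r A] True \<open>k \<notin> A\<close> nest by (metis not_le)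
      ultimately show ?thesis using levi nest True by auto
    next
      case False
      then have "lev r A k = 2 * q \<or> lev r A k = 2 * q + 2"
        using k(2) by (auto simp: g_def lev_def split: if_splits)
      moreover have "k \<le> j \<longleftrightarrow> lev r A j \<le> lev r A k"
        using lev_hi_strict[of j k] lev_antimono[OF finite_A, of r k j] False ij nest by (metis not_le)
      ultimately show ?thesis using levj nest False by auto
    qed
    show ?thesis
    proof (rule merge[OF nc fij])
      fix k l
      show "block_label k = block_label l \<longleftrightarrow>
        f k = f l \<and> (f k = f j \<longrightarrow> (i < k \<and> k \<le> j \<longleftrightarrow> i < l \<and> l \<le> j))"
      proof (cases "in_block k \<and> in_block l")
        case True
        then show ?thesis
          using inside[of k] inside[of l] ib gj by (auto simp: block_label_def f_def g_def split: if_splits)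
      next
        case False
        then show ?thesis using ib by (auto simp: block_label_def f_def)
      qed
    qed
  qed
qed

end

section \<open>Chains of initial segments\<close>

text \<open>The sets \<open>{k. k < n \<and> h k < t}\<close> are the initial segments of the points
  listed by increasing \<open>h\<close>. The excess of \<open>B\<close> over \<open>[r]\<close> in
  each of them has to be \<open>0\<close> or \<open>1\<close>.\<close>

definition balanced :: "nat \<Rightarrow> nat \<Rightarrow> (nat \<Rightarrow> nat) \<Rightarrow> nat set \<Rightarrow> bool" where
  "balanced r n h B \<longleftrightarrow> (\<forall>t. card ({k. k < n \<and> h k < t} \<inter> {..<r}) \<le> card (B \<inter> {k. k < n \<and> h k < t}) \<and>
     card (B \<inter> {k. k < n \<and> h k < t}) \<le> card ({k. k < n \<and> h k < t} \<inter> {..<r}) + 1)"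

text \<open>The monotonicity makes every \<open>T t\<close> the union of an initial piece of
  \<open>[r]\<close> and a final piece of \<open>{r..<n}\<close>.\<close>

locale chain =
  fixes r n :: nat and h :: "nat \<Rightarrow> nat"
  assumes rn: "r \<le> n"
    and h_lo: "\<And>k l. k < l \<Longrightarrow> l < r \<Longrightarrow> h k < h l"
    and h_hi: "\<And>k l. r \<le> k \<Longrightarrow> k < l \<Longrightarrow> l < n \<Longrightarrow> h l < h k"
    and h_cross: "\<And>k l. k < r \<Longrightarrow> r \<le> l \<Longrightarrow> l < n \<Longrightarrow> h k \<noteq> h l"
begin

abbreviation T :: "nat \<Rightarrow> nat set" where "T t \<equiv> {k. k < n \<and> h k < t}"

lemma h_inj:
  assumes "k < n" "l < n"
  shows "h k = h l \<longleftrightarrow> k = l"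
proof -
  have ne: "h k \<noteq> h l" if "k < l" "l < n" for k l
    using h_lo[OF that(1)] h_cross[of k l] h_hi[OF _ that] that(2)
    by (metis less_irrefl not_le_imp_less)
  show ?thesis using ne[of k l] ne[of l k] assms by (cases k l rule: linorder_cases) auto
qed

lemma T_Suc: "k < n \<Longrightarrow> T (Suc (h k)) = insert k (T (h k))"
  using h_inj[of _ k] by (auto simp: less_Suc_eq)

text \<open>Adding \<open>x\<close> to the segment raises the count for \<open>[r]\<close> alone and
  so lowers the excess, which must therefore be \<open>1\<close> before.\<close>

lemma balanced_lo:
  assumes "balanced r n h B" "x < r" "x \<notin> B"
  shows "card (B \<inter> T (h x)) = card (T (h x) \<inter> {..<r}) + 1"
proof -
  have "B \<inter> T (Suc (h x)) = B \<inter> T (h x)" and "T (Suc (h x)) \<inter> {..<r} = insert x (T (h x) \<inter> {..<r})"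
    using T_Suc[of x] assms rn by auto
  then have "card (B \<inter> T (Suc (h x))) = card (B \<inter> T (h x))"
    "card (T (Suc (h x)) \<inter> {..<r}) = Suc (card (T (h x) \<inter> {..<r}))" by auto
  then show ?thesis using assms(1)[unfolded balanced_def, rule_format, of "h x"]
      assms(1)[unfolded balanced_def, rule_format, of "Suc (h x)"] by linarith
qed

text \<open>Dually, adding \<open>z\<close> raises the count for \<open>B\<close> alone, so the
  excess before it is \<open>0\<close>.\<close>

lemma balanced_hi:
  assumes "balanced r n h B" "r \<le> z" "z < n" "z \<in> B"
  shows "card (B \<inter> T (h z)) = card (T (h z) \<inter> {..<r})"
proof -
  have "B \<inter> T (Suc (h z)) = insert z (B \<inter> T (h z))" and "T (Suc (h z)) \<inter> {..<r} = T (h z) \<inter> {..<r}"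
    using T_Suc[of z] assms rn by auto
  then have "card (B \<inter> T (Suc (h z))) = Suc (card (B \<inter> T (h z)))"
    "card (T (Suc (h z)) \<inter> {..<r}) = card (T (h z) \<inter> {..<r})" by auto
  then show ?thesis using assms(1)[unfolded balanced_def, rule_format, of "h z"]
      assms(1)[unfolded balanced_def, rule_format, of "Suc (h z)"] by linarith
qed

lemma card_exchange:
  assumes "i \<notin> B" "j \<in> B" "finite B" "i < n" "j < n"
  shows "card (insert i (B - {j}) \<inter> T t) + (if h j < t then 1 else 0) = card (B \<inter> T t) + (if h i < t then 1 else 0)"
proof -
  have "card (insert i (B - {j}) \<inter> T t) = card ((B - {j}) \<inter> T t) + (if h i < t then 1 else 0)"
    using assms by (auto simp: Int_insert_left)
  moreover have "card (B \<inter> T t) = card ((B - {j}) \<inter> T t) + (if h j < t then 1 else 0)"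
  proof (cases "h j < t")
    case True
    then have "B \<inter> T t = insert j ((B - {j}) \<inter> T t)" using assms by auto
    then have "card (B \<inter> T t) = Suc (card ((B - {j}) \<inter> T t))" using assms by simp
    then show ?thesis using True by simp
  next
    case False
    then have "B \<inter> T t = (B - {j}) \<inter> T t" by auto
    then show ?thesis using False by simp
  qed
  ultimately show ?thesis by simp
qed

text \<open>On a segment containing just one of \<open>i\<close> and \<open>j\<close> the exchange
  shifts the excess by one, so balance of both sets determines it. By \<open>balanced_lo\<close> and
  \<open>balanced_hi\<close> no further missing (respectively extra) point can come between
  \<open>i\<close> and \<open>j\<close> in the chain, and counting in the segment just before the
  later of the two compares their levels.\<close>

lemma balanced_close:
  assumes B: "balanced r n h B" "B \<subseteq> {..<n}" and B': "balanced r n h (insert i (B - {j}))"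
    and ij: "i \<notin> B" "j \<in> B" "i < j"
  shows "close_levels r B i j"
proof -
  have jn: "j < n" "i < n" using B(2) ij by auto
  have fin: "finite B" using B(2) finite_subset by blast
  note ex = card_exchange[OF ij(1,2) fin jn(2,1)]
  have b: "card (T t \<inter> {..<r}) \<le> card (B \<inter> T t)" "card (B \<inter> T t) \<le> card (T t \<inter> {..<r}) + 1"
    "card (T t \<inter> {..<r}) \<le> card (insert i (B - {j}) \<inter> T t)"
    "card (insert i (B - {j}) \<inter> T t) \<le> card (T t \<inter> {..<r}) + 1" for t
    using B B' by (auto simp: balanced_def)
  \<comment> \<open>The excess of \<open>B\<close> in \<open>T t\<close> equals the number of extra
    points minus the number of missing points.\<close>
  have split: "card (B \<inter> T t) + card (T t \<inter> {..<r} - B) = card (T t \<inter> {..<r}) + card (B \<inter> T t - {..<r})" for t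
  proof -
    have "card (B \<inter> T t) = card (B \<inter> T t \<inter> {..<r}) + card (B \<inter> T t - {..<r})"
      using card_Int_Diff[of "B \<inter> T t" "{..<r}"] by simp
    moreover have "card (T t \<inter> {..<r}) = card (T t \<inter> {..<r} \<inter> B) + card (T t \<inter> {..<r} - B)"
      using card_Int_Diff[of "T t \<inter> {..<r}" B] by simp
    moreover have "B \<inter> T t \<inter> {..<r} = T t \<inter> {..<r} \<inter> B" by auto
    ultimately show ?thesis by simp
  qed
  consider (lo) "j < r" | (hi) "r \<le> i" | (up) "i < r" "r \<le> j" "h i < h j" | (down) "i < r" "r \<le> j" "h j < h i"
    using h_cross[of i j] jn by linarith
  then show ?thesis
  proof cases
    case lo
    have "x \<in> B" if x: "i < x" "x \<le> j" for x
    proof (rule ccontr)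
      assume "x \<notin> B"
      then have "x < j" using x ij by (metis le_neq_implies_less)
      then have "h i < h x" "h x < h j" using h_lo x lo by auto
      then show False
        using balanced_lo[OF B(1), of x] ex[of "h x"] b(4)[of "h x"] \<open>x \<notin> B\<close> \<open>x < j\<close> lo by simp
    qed
    then have "x \<in> {..i} - B \<longleftrightarrow> x \<in> {..j} - B" for x using ij by (cases "x \<le> i") auto
    then have "{..i} - B = {..j} - B" by blast
    then show ?thesis using lo ij by (simp add: lev_def)
  next
    case hi
    have "z \<notin> B" if z: "i \<le> z" "z < j" for z
    proof
      assume "z \<in> B"
      then have "i < z" using z ij by (metis le_neq_implies_less)
      then have "h j < h z" "h z < h i" using h_hi z hi jn by auto
      then show False
        using balanced_hi[OF B(1), of z] ex[of "h z"] b(3)[of "h z"] \<open>z \<in> B\<close> \<open>i < z\<close> z hi jn by simp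
    qed
    then have "x \<in> B \<inter> {i..} \<longleftrightarrow> x \<in> B \<inter> {j..}" for x using ij by (cases "x < j") auto
    then have "B \<inter> {i..} = B \<inter> {j..}" by blast
    then show ?thesis using hi ij by (simp add: lev_def)
  next
    case up
    \<comment> \<open>The segment contains \<open>i\<close> but not \<open>j\<close>, so the
      exchange raises the excess from \<open>0\<close> to \<open>1\<close>.\<close>
    have eq: "card (B \<inter> T (h j)) = card (T (h j) \<inter> {..<r})"
      using ex[of "h j"] b(1,4)[of "h j"] up by simp
    have "k \<le> i \<longleftrightarrow> h k < h j" if k: "k < r" "k \<notin> B" for k
    proof
      show "h k < h j" if "k \<le> i" using h_lo[of k i] that up by (cases "k = i") auto
      show "k \<le> i" if "h k < h j"
      proof (rule ccontr)
        assume "\<not> k \<le> i"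
        then have "h i < h k" using h_lo[of i k] k by simp
        then show False using balanced_lo[OF B(1) k] ex[of "h k"] b(4)[of "h k"] that by simp
      qed
    qed
    then have "k \<in> T (h j) \<inter> {..<r} - B \<longleftrightarrow> k \<in> {..i} - B" for k using up rn by (cases "k < r") auto
    then have lo: "T (h j) \<inter> {..<r} - B = {..i} - B" by blast
    have "k \<in> B \<inter> {j..} \<longleftrightarrow> k \<in> insert j (B \<inter> T (h j) - {..<r})" for k
    proof (cases "r \<le> k \<and> k < n")
      case True
      then have "j < k \<longleftrightarrow> h k < h j" using h_hi[of j k] h_hi[of k j] jn up
        by (metis less_asym linorder_neqE_nat less_irrefl)
      then show ?thesis using True ij by auto
    next
      case False
      then show ?thesis using B(2) up jn ij by auto
    qed
    then have "B \<inter> {j..} = insert j (B \<inter> T (h j) - {..<r})" by blast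
    moreover have "card (insert j (B \<inter> T (h j) - {..<r})) = Suc (card (B \<inter> T (h j) - {..<r}))"
      by (rule card_insert_disjoint) (use fin in auto)
    ultimately have "card (B \<inter> {j..}) = Suc (card ({..i} - B))"
      using split[of "h j"] eq lo by simp
    then show ?thesis using up by (simp add: lev_def)
  next
    case down
    \<comment> \<open>The segment contains \<open>j\<close> but not \<open>i\<close>, so the
      exchange lowers the excess from \<open>1\<close> to \<open>0\<close>.\<close>
    have eq: "card (B \<inter> T (h i)) = card (T (h i) \<inter> {..<r}) + 1"
      using ex[of "h i"] b(2,3)[of "h i"] down by simp
    have "j \<le> k \<longleftrightarrow> h k < h i" if k: "r \<le> k" "k \<in> B" for k
    proof
      show "h k < h i" if "j \<le> k" using h_hi[of j k] that down B(2) k by (cases "k = j") auto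
      show "j \<le> k" if "h k < h i"
      proof (rule ccontr)
        assume "\<not> j \<le> k"
        then have "h j < h k" using h_hi[of k j] k jn by simp
        then show False using balanced_hi[OF B(1) k(1) _ k(2)] B(2) k ex[of "h k"] b(3)[of "h k"] that by auto
      qed
    qed
    then have "k \<in> B \<inter> T (h i) - {..<r} \<longleftrightarrow> k \<in> B \<inter> {j..}" for k
      using down B(2) by (cases "r \<le> k") auto
    then have hi: "B \<inter> T (h i) - {..<r} = B \<inter> {j..}" by blast
    have "k \<in> {..i} - B \<longleftrightarrow> k \<in> insert i (T (h i) \<inter> {..<r} - B)" for k
    proof (cases "k < r")
      case True
      then have "k < i \<longleftrightarrow> h k < h i" using h_lo[of i k] h_lo[of k i] down
        by (metis less_asym linorder_neqE_nat less_irrefl)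
      then show ?thesis using True ij rn by auto
    next
      case False
      then show ?thesis using down by auto
    qed
    then have "{..i} - B = insert i (T (h i) \<inter> {..<r} - B)" by blast
    moreover have "card (insert i (T (h i) \<inter> {..<r} - B)) = Suc (card (T (h i) \<inter> {..<r} - B))"
      by (rule card_insert_disjoint) auto
    ultimately have "card ({..i} - B) = card (B \<inter> {j..})"
      using split[of "h i"] eq hi by simp
    then show ?thesis using down by (simp add: lev_def)
  qed
qed

end

section \<open>The chain of a subset and its exchanges\<close>

context level_subset
begin

text \<open>Lists the points by level, with ties broken upwards in \<open>[r]\<close> and downwards
  outside. For \<open>k < n\<close> the second summand is below \<open>n\<close>, so the level
  dominates.\<close>

definition time :: "nat \<Rightarrow> nat" where
  "time k = lev r A k * n + (if k < r then k else n - 1 - k)"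

lemma time_lev:
  assumes "lev r A k < lev r A l" "k < n"
  shows "time k < time l"
proof -
  have "time k < Suc (lev r A k) * n" using assms(2) by (auto simp: time_def)
  also have "\<dots> \<le> lev r A l * n" using assms(1) by (intro mult_le_mono) auto
  finally show ?thesis by (simp add: time_def)
qed

lemma chain_time: "chain r n time"
proof
  show "r \<le> n" by (rule rn)
  show "time k < time l" if "k < l" "l < r" for k l
    using that lev_mono[of k l r A] by (auto simp: time_def intro: add_le_less_mono)
  show "time l < time k" if "r \<le> k" "k < l" "l < n" for k l
  proof -
    have "lev r A l * n \<le> lev r A k * n" using lev_antimono[OF finite_A, of r k l] that by (intro mult_le_mono1) simp
    moreover have "n - 1 - l < n - 1 - k" using that by simp
    ultimately have "lev r A l * n + (n - 1 - l) < lev r A k * n + (n - 1 - k)" by (rule add_le_less_mono)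
    then show ?thesis using that by (simp add: time_def)
  qed
  show "time k \<noteq> time l" if "k < r" "r \<le> l" "l < n" for k l
  proof -
    have "odd (lev r A k)" "even (lev r A l)" using that by (auto simp: lev_def)
    then have "lev r A k \<noteq> lev r A l" by metis
    then show ?thesis using time_lev[of k l] time_lev[of l k] that rn by (metis less_le_trans less_irrefl linorder_neqE_nat)
  qed
qed

text \<open>\<open>A\<close> itself is balanced. When its excess over \<open>[r]\<close> in an initial segment is \<open>0\<close>, exchanges between
  close levels can only move one element into the segment, namely to the last missing point
  in it; when the excess is \<open>1\<close>, they can only move out the last extra point.\<close>

lemma balanced_exchange:
  assumes \<rho>: "inj_on \<rho> A"
    and ex: "\<And>j. j \<in> A \<Longrightarrow> \<rho> j = j \<or> (\<rho> j < j \<and> \<rho> j \<notin> A \<and> close_levels r A (\<rho> j) j)"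
  shows "balanced r n time (\<rho> ` A)"
  unfolding balanced_def
proof
  fix t
  interpret chain r n time by (rule chain_time)
  define S where "S = {k. k < n \<and> time k < t}"
  \<comment> \<open>\<open>p\<close> counts the missing and \<open>s\<close> the extra points in the
    segment \<open>S\<close>; the excess of \<open>A\<close> there is \<open>s - p\<close>.\<close>
  define p where "p = card (S \<inter> {..<r} - A)"
  define s where "s = card (A \<inter> S - {..<r})"
  have finS: "finite S" by (simp add: S_def)
  have S_lev: "k \<in> S" if "l \<in> S" "lev r A k < lev r A l" "k < n" for k l
    using time_lev[OF that(2,3)] that by (simp add: S_def)
  have S_lo: "k \<in> S" if "l \<in> S" "k \<le> l" "l < r" for k l
    using that h_lo[of k l] rn by (cases "k = l") (auto simp: S_def)
  have S_hi: "l \<in> S" if "k \<in> S" "r \<le> k" "k \<le> l" "l < n" for k l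
    using that h_hi[of k l] by (cases "k = l") (auto simp: S_def)
  have lo_in: "lev r A x \<le> 2 * p + 1" if "x \<in> S" "x < r" for x
  proof -
    have "card ({..x} - A) \<le> p" unfolding p_def using S_lo that by (intro card_mono) (auto simp: finS)
    then show ?thesis using that by (simp add: lev_def)
  qed
  have lo_out: "2 * p + 3 \<le> lev r A x" if "x \<notin> S" "x < r" "x \<notin> A" for x
  proof -
    have "insert x (S \<inter> {..<r} - A) \<subseteq> {..x} - A" 
    proof
      fix y assume "y \<in> insert x (S \<inter> {..<r} - A)"
      then show "y \<in> {..x} - A" using S_lo[of y x] that by (cases "y \<le> x") auto
    qed
    then have "card (insert x (S \<inter> {..<r} - A)) \<le> card ({..x} - A)" by (intro card_mono) auto
    then show ?thesis using that finS by (simp add: lev_def p_def)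
  qed
  have hi_in: "lev r A z \<le> 2 * s" if "z \<in> S" "r \<le> z" for z
  proof -
    have "card (A \<inter> {z..}) \<le> s" unfolding s_def using S_hi[OF that] that A
      by (intro card_mono) (auto simp: finS)
    then show ?thesis using that by (simp add: lev_def)
  qed
  have hi_out: "2 * s + 2 \<le> lev r A z" if "z \<notin> S" "r \<le> z" "z \<in> A" for z
  proof -
    have "insert z (A \<inter> S - {..<r}) \<subseteq> A \<inter> {z..}" 
    proof
      fix y assume "y \<in> insert z (A \<inter> S - {..<r})"
      then show "y \<in> A \<inter> {z..}" using S_hi[of y z] that A by (cases "z \<le> y") auto
    qed
    then have "card (insert z (A \<inter> S - {..<r})) \<le> card (A \<inter> {z..})" using finite_A by (intro card_mono) auto
    then show ?thesis using that finS by (simp add: lev_def s_def)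
  qed
  have p_le: "p \<le> card ({..<r} - A)" unfolding p_def by (intro card_mono) auto
  have s_le: "s \<le> card ({..<r} - A)" unfolding s_def card_missing using finite_A by (intro card_mono) auto
  have last_lo: "\<exists>x. x \<in> S \<and> x < r \<and> x \<notin> A \<and> lev r A x = 2 * p + 1" if p1: "1 \<le> p"
  proof -
    obtain x where "x \<notin> A" "x < r" "lev r A x = 2 * p + 1" using ex_lev_lo[OF p1 p_le] .
    then show ?thesis using lo_out[of x] by auto
  qed
  have last_hi: "\<exists>z. z \<in> S \<and> r \<le> z \<and> z < n \<and> z \<in> A \<and> lev r A z = 2 * s" if s1: "1 \<le> s"
  proof -
    obtain z where "z \<in> A" "r \<le> z" "lev r A z = 2 * s" using ex_lev_hi[OF s1 s_le] .
    then show ?thesis using hi_out[of z] A by auto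
  qed
  \<comment> \<open>Missing and extra points alternate in the chain, starting with
    \<open>z\<^sub>1\<close>, so the extra ones are ahead by at most one.\<close>
  have "p \<le> s"
  proof (rule ccontr)
    assume "\<not> p \<le> s"
    then obtain z where "z \<in> A" "r \<le> z" "lev r A z = 2 * (s + 1)" using ex_lev_hi[of "s + 1"] p_le by auto
    moreover obtain x where "x \<in> S" "lev r A x = 2 * p + 1" using last_lo \<open>\<not> p \<le> s\<close> by auto
    ultimately show False using hi_in[of z] S_lev[of x z] A \<open>\<not> p \<le> s\<close> by auto
  qed
  moreover have "s \<le> p + 1"
  proof (rule ccontr)
    assume "\<not> s \<le> p + 1"
    then obtain x where "x \<notin> A" "x < r" "lev r A x = 2 * (p + 1) + 1" using ex_lev_lo[of "p + 1"] s_le by auto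
    moreover obtain z where "z \<in> S" "lev r A z = 2 * s" using last_hi \<open>\<not> s \<le> p + 1\<close> by auto
    ultimately show False using lo_in[of x] S_lev[of z x] rn \<open>\<not> s \<le> p + 1\<close> by auto
  qed
  ultimately have cs: "s = p \<or> s = p + 1" by linarith
  let ?up = "{j\<in>A. j \<notin> S \<and> \<rho> j \<in> S}" and ?down = "{j\<in>A. j \<in> S \<and> \<rho> j \<notin> S}"
  have card\<rho>: "card (\<rho> ` A \<inter> S) + card ?down = card (A \<inter> S) + card ?up"
    by (rule card_image_Int[OF finite_A \<rho>])
  have cardA: "card (A \<inter> S) + p = card (S \<inter> {..<r}) + s"
  proof -
    have "card (A \<inter> S) = card (A \<inter> S \<inter> {..<r}) + s"
      unfolding s_def using card_Int_Diff[of "A \<inter> S" "{..<r}"] finS by simp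
    moreover have "card (S \<inter> {..<r}) = card (S \<inter> {..<r} \<inter> A) + p"
      unfolding p_def using card_Int_Diff[of "S \<inter> {..<r}" A] by simp
    moreover have "A \<inter> S \<inter> {..<r} = S \<inter> {..<r} \<inter> A" by auto
    ultimately show ?thesis by simp
  qed
  \<comment> \<open>Exchanges move points downwards, and within \<open>{r..<n}\<close> the segment
    is closed upwards; hence a point enters \<open>S\<close> only by landing in \<open>[r]\<close>.
    Dually, \<open>S\<close> is closed downwards in \<open>[r]\<close>, so a point leaves
    \<open>S\<close> only from outside \<open>[r]\<close>.\<close>
  have up: "\<rho> j < r" "\<rho> j \<notin> A" "close_levels r A (\<rho> j) j" "lev r A (\<rho> j) \<le> 2 * p + 1"
    if "j \<in> ?up" for j
  proof -
    have j: "j \<in> A" "j \<notin> S" "\<rho> j \<in> S" using that by auto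
    have e: "\<rho> j < j" "\<rho> j \<notin> A" "close_levels r A (\<rho> j) j" using ex[OF j(1)] j by auto
    have "\<rho> j < r" using S_hi[of "\<rho> j" j] j e A by (metis less_imp_le not_le lessThan_iff subsetD)
    then show "\<rho> j < r" "\<rho> j \<notin> A" "close_levels r A (\<rho> j) j" "lev r A (\<rho> j) \<le> 2 * p + 1"
      using e lo_in j by auto
  qed
  have down: "r \<le> j" "\<rho> j \<notin> A" "close_levels r A (\<rho> j) j" "lev r A j \<le> 2 * s" "\<rho> j < n"
    if "j \<in> ?down" for j
  proof -
    have j: "j \<in> A" "j \<in> S" "\<rho> j \<notin> S" using that by auto
    have e: "\<rho> j < j" "\<rho> j \<notin> A" "close_levels r A (\<rho> j) j" using ex[OF j(1)] j by auto
    have "r \<le> j" using S_lo[of j "\<rho> j"] j e by (metis less_imp_le not_le)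
    then show "r \<le> j" "\<rho> j \<notin> A" "close_levels r A (\<rho> j) j" "lev r A j \<le> 2 * s" "\<rho> j < n"
      using e hi_in j A by auto
  qed
  have par: "even (lev r A k)" if "r \<le> k" for k using that by (simp add: lev_def)
  have par': "odd (lev r A k)" if "k < r" for k using that by (simp add: lev_def)
  have "card (S \<inter> {..<r}) \<le> card (\<rho> ` A \<inter> S) \<and> card (\<rho> ` A \<inter> S) \<le> card (S \<inter> {..<r}) + 1"
    using cs
  proof
    assume sp: "s = p"
    \<comment> \<open>Excess \<open>0\<close>: a leaving point has level at most
      \<open>2 * p\<close>. Its target is either a missing point of level at least
      \<open>2 * p + 3\<close>, too far away, or lies outside \<open>[r]\<close> with level at most
      \<open>2 * p\<close>, hence before the last missing point of \<open>S\<close> and thus in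
      \<open>S\<close>.\<close>
    have False if "j \<in> ?down" for j
    proof -
      have j: "j \<in> A" "\<rho> j \<notin> S" using that by auto
      note d = down[OF that]
      have "2 \<le> lev r A j" using lev_hi_pos d(1) j by blast
      then have "1 \<le> p" using d(4) sp by linarith
      then obtain x where x: "x \<in> S" "lev r A x = 2 * p + 1" using last_lo by blast
      have "r \<le> \<rho> j"
      proof (rule ccontr)
        assume "\<not> r \<le> \<rho> j"
        then show False using lo_out[of "\<rho> j"] j d sp by auto
      qed
      then have "even (lev r A (\<rho> j))" by (rule par)
      then have "lev r A (\<rho> j) < lev r A x" using d(3,4) sp x(2) by presburger
      then show False using S_lev[OF x(1) _ d(5)] j by blast
    qed
    then have "?down = {}" by blast
    then have c0: "card ?down = 0" by (simp only: card.empty)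
    have eq: "lev r A (\<rho> j) = 2 * p + 1" if "j \<in> ?up" for j
    proof -
      have j: "j \<in> A" "j \<notin> S" "j < n" using that A by auto
      note u = up[OF that]
      have "3 \<le> lev r A (\<rho> j)" using lev_lo_ge u(1,2) by blast
      then have "1 \<le> p" using u(4) by linarith
      then obtain x where x: "x \<in> S" "lev r A x = 2 * p + 1" using last_lo by blast
      have "2 * p + 1 \<le> lev r A j" using S_lev[OF x(1), of j] j x(2) by linarith
      then show ?thesis using u(3,4) par'[OF u(1)] by presburger
    qed
    \<comment> \<open>Missing points have distinct levels, so only one exchange can land on level
      \<open>2 * p + 1\<close>.\<close>
    have "card ?up \<le> card {2 * p + 1}"
    proof (rule card_inj_on_le)
      show "inj_on (\<lambda>j. lev r A (\<rho> j)) ?up"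
      proof (rule inj_onI)
        fix j k assume jk: "j \<in> ?up" "k \<in> ?up" "lev r A (\<rho> j) = lev r A (\<rho> k)"
        have "\<rho> j = \<rho> k"
          using lev_lo_strict[of "\<rho> j" "\<rho> k"] lev_lo_strict[of "\<rho> k" "\<rho> j"] up[OF jk(1)] up[OF jk(2)] jk(3)
          by (metis less_irrefl linorder_neqE_nat)
        then show "j = k" using \<rho> jk by (auto dest: inj_onD)
      qed
      show "(\<lambda>j. lev r A (\<rho> j)) ` ?up \<subseteq> {2 * p + 1}" using eq by blast
    qed simp
    then show ?thesis using card\<rho> cardA c0 sp by simp
  next
    assume sp: "s = p + 1"
    obtain z where z: "z \<in> S" "lev r A z = 2 * s" using last_hi sp by auto
    \<comment> \<open>Excess \<open>1\<close>: the target has level at most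
      \<open>2 * s - 1\<close>, so closeness forces \<open>j\<close> to level \<open>2 * s\<close>.
      But extra points not in \<open>S\<close> have level at least \<open>2 * s + 2\<close>.\<close>
    have False if "j \<in> ?up" for j
    proof -
      have j: "j \<in> A" "j \<notin> S" "j < n" using that A by auto
      note u = up[OF that]
      have "2 * s \<le> lev r A j" using S_lev[OF z(1), of j] j z(2) by linarith
      then have "lev r A j = 2 * s" using u(3,4) sp by linarith
      moreover have "r \<le> j" using par'[of j] calculation by (metis dvd_triv_left not_le)
      ultimately show False using hi_out[of j] j by simp
    qed
    then have "?up = {}" by blast
    then have c0: "card ?up = 0" by (simp only: card.empty)
    have eq: "lev r A j = 2 * s" if "j \<in> ?down" for j
    proof -
      have j: "j \<in> A" "\<rho> j \<notin> S" using that by auto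
      note d = down[OF that]
      have "2 * s \<le> lev r A (\<rho> j)" using S_lev[OF z(1), of "\<rho> j"] j z(2) d(5) by linarith
      then show ?thesis using d(3,4) par[OF d(1)] by presburger
    qed
    have "card ?down \<le> card {2 * s}"
    proof (rule card_inj_on_le)
      show "inj_on (lev r A) ?down"
      proof (rule inj_onI)
        fix j k assume jk: "j \<in> ?down" "k \<in> ?down" "lev r A j = lev r A k"
        show "j = k"
          using lev_hi_strict[of j k] lev_hi_strict[of k j] down[OF jk(1)] down[OF jk(2)] jk
          by (metis (no_types, lifting) less_irrefl linorder_neqE_nat mem_Collect_eq)
      qed
      show "lev r A ` ?down \<subseteq> {2 * s}" using eq by blast
    qed simp
    then show ?thesis using card\<rho> cardA c0 sp by simp
  qed
  then show "card ({k. k < n \<and> time k < t} \<inter> {..<r}) \<le> card (\<rho> ` A \<inter> {k. k < n \<and> time k < t}) \<and>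
    card (\<rho> ` A \<inter> {k. k < n \<and> time k < t}) \<le> card ({k. k < n \<and> time k < t} \<inter> {..<r}) + 1"
    by (simp add: S_def)
qed

end

section \<open>Edges of the quasisymmetric Johnson graph\<close>

lemma NC_inv_eq:
  assumes "w \<in> NC n"
  shows "Hilbert_Choice.inv w i = k \<longleftrightarrow> w k = i"
  using permutes_inverses[OF NC_permutes[OF assms]] by metis

lemma level_subset_NC_image:
  assumes "w \<in> NC n" "r \<le> n"
  shows "level_subset r n (w ` {..<r})"
proof
  note perm = NC_permutes[OF assms(1)]
  have "w ` {..<r} \<subseteq> w ` {..<n}" using assms(2) by (intro image_mono) simp
  then show "w ` {..<r} \<subseteq> {..<n}" using permutes_image[OF perm] by simp
  show "card (w ` {..<r}) = r"
    using card_image[OF inj_on_subset[OF permutes_inj[OF perm] subset_UNIV]] by simp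
  show "r \<le> n" by fact
qed

lemma image_transpose_exchange:
  assumes "i \<notin> A" "j \<in> A"
  shows "Transposition.transpose i j ` A = insert i (A - {j})"
proof -
  have "A = insert j (A - {j})" using assms by blast
  then have "Transposition.transpose i j ` A = insert i (Transposition.transpose i j ` (A - {j}))"
    by (metis image_insert transpose_apply_second)
  also have "Transposition.transpose i j ` (A - {j}) = id ` (A - {j})"
    using assms by (intro image_cong) (auto simp: transpose_def)
  finally show ?thesis by simp
qed

lemma Inv_NC_kreweras_pair:
  assumes w: "w \<in> NC n" and ij: "(i, j) \<in> Inv_NC n w"
  shows "kreweras_pair n w (Transposition.transpose i j \<circ> w) i j (Hilbert_Choice.inv w i) (Hilbert_Choice.inv w j)"
  using ij w NC_inv_eq[OF w] by unfold_locales (auto simp: Inv_NC_def Inv_def)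

context level_subset
begin

lemma exchange_card:
  assumes "i \<notin> A" "j \<in> A"
  shows "card (insert i (A - {j})) = r"
  using assms A finite_A card_Suc_Diff1[of A j] by simp

lemma close_imp_edge:
  assumes ij: "i \<notin> A" "j \<in> A" "i < j" and close: "close_levels r A i j"
  shows "{A, insert i (A - {j})} \<in> quasisymmetric_johnson_edges r n"
proof -
  have n: "i < n" "j < n" using ij A by auto
  let ?u = "Transposition.transpose i j \<circ> cell_perm"
  have "?u ` {..<r} = insert i (A - {j})"
    unfolding image_comp[symmetric] cell_perm_image by (rule image_transpose_exchange[OF ij(1,2)])
  moreover have "kreweras_adjacent n cell_perm ?u"
    unfolding kreweras_adjacent_def
    using cell_perm_NC cell_perm_swap_NC[OF ij close] ij(3) n by blast
  moreover have "{A, insert i (A - {j})} \<in> johnson_edges r n"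
    unfolding johnson_edges_def subsets_of_size_def
    using A ij n exchange_card[OF ij(1,2)] by blast
  ultimately show ?thesis
    unfolding quasisymmetric_johnson_edges_def
    by (intro CollectI exI[of _ A] exI[of _ "insert i (A - {j})"] conjI refl
        exI[of _ cell_perm] exI[of _ ?u]) (simp_all only: cell_perm_image)
qed

text \<open>The permutations witnessing the edge are arbitrary, but the transposition between them
  carries \<open>A\<close> to its neighbour and so must be that of \<open>i\<close> and
  \<open>j\<close>; the bound of \<open>kreweras_pair\<close> then applies.\<close>

lemma edge_imp_close:
  assumes ij: "i \<notin> A" "j \<in> A" "i < j"
    and edge: "{A, insert i (A - {j})} \<in> quasisymmetric_johnson_edges r n"
  shows "close_levels r A i j"
proof -
  let ?B = "insert i (A - {j})"
  obtain w u where wu: "kreweras_adjacent n w u" "A = w ` {..<r}" "?B = u ` {..<r}"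
  proof -
    obtain C D w u where *: "{A, ?B} = {C, D}" "{C, D} \<in> johnson_edges r n" "kreweras_adjacent n w u" "C = w ` {..<r}" "D = u ` {..<r}"
      using edge unfolding quasisymmetric_johnson_edges_def mem_Collect_eq by (elim exE conjE) (rule that)
    \<comment> \<open>Edges are unordered pairs, so the witnesses may come in the wrong
      order.\<close>
    have sym: "kreweras_adjacent n u w"
    proof -
      obtain a b where ab: "a < n" "b < n" "a \<noteq> b" "u = Transposition.transpose a b \<circ> w"
        using *(3) unfolding kreweras_adjacent_def by blast
      then have "w = Transposition.transpose a b \<circ> u" by (simp add: fun_eq_iff)
      then show ?thesis using *(3) ab unfolding kreweras_adjacent_def by blast
    qed
    from *(1) have "A = C \<and> ?B = D \<or> A = D \<and> ?B = C" by (simp only: doubleton_eq_iff)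
    then show ?thesis using that[of w u] that[of u w] *(3-5) sym by (elim disjE conjE) simp_all
  qed
  obtain a b where ab: "a \<noteq> b" "u = Transposition.transpose a b \<circ> w" and NC: "w \<in> NC n" "u \<in> NC n"
    using wu(1) unfolding kreweras_adjacent_def by blast
  have img: "Transposition.transpose a b ` A = ?B"
    using wu ab by (simp add: image_comp)
  have "j \<in> {a, b}"
  proof (rule ccontr)
    assume "j \<notin> {a, b}"
    then have "Transposition.transpose a b j = j" by (simp add: transpose_def)
    then have "j \<in> ?B" using img ij by (metis imageI)
    then show False using ij by auto
  qed
  moreover have "i \<in> {a, b}"
  proof (rule ccontr)
    assume i: "i \<notin> {a, b}"
    have "i \<in> Transposition.transpose a b ` A" unfolding img by simp
    then obtain x where x: "x \<in> A" "Transposition.transpose a b x = i" by (elim imageE) simp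
    then have "x = i" using i by (auto simp: transpose_def split: if_splits)
    then show False using x ij by simp
  qed
  ultimately have u: "u = Transposition.transpose i j \<circ> w"
    using ab ij(3) by (auto simp: transpose_commute)
  have n: "j < n" using ij A by auto
  let ?a = "Hilbert_Choice.inv w i" and ?b = "Hilbert_Choice.inv w j"
  have inv: "w ?a = i" "w ?b = j" 
    using NC_inv_eq[OF NC(1), of i ?a] NC_inv_eq[OF NC(1), of j ?b] by simp_all
  have "?b < r"
  proof -
    obtain k where "k < r" "w k = j" using wu(2) ij by auto
    then show ?thesis using NC_inv_eq[OF NC(1), of j k] by simp
  qed
  moreover have "r \<le> ?a"
  proof (rule ccontr)
    assume "\<not> r \<le> ?a"
    then have "i \<in> A" using inv wu(2) by (metis imageI lessThan_iff not_le)
    then show False using ij by simp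
  qed
  ultimately interpret kreweras_pair n r w u i j ?a ?b
    using NC u ij n inv by unfold_locales auto
  show ?thesis using close[OF \<open>?b < r\<close> \<open>r \<le> ?a\<close> rn] wu(2) by simp
qed

end

text \<open>\<open>\<tau>\<close> lists the rows used by a nonzero Leibniz term. Column
  \<open>k\<close> uses its pivot row \<open>w k\<close> or a smaller row from a noncrossing
  inversion, so \<open>B\<close> arises from \<open>w [r]\<close> by injective exchanges and
  \<open>balanced_exchange\<close> applies.\<close>

lemma nc_matrix_balanced:
  assumes w: "w \<in> NC n" and M: "M \<in> nc_matrices n w" and rn: "r \<le> n"
    and \<tau>: "bij_betw \<tau> {..<r} B" "B \<subseteq> {..<n}" "\<And>k. k < r \<Longrightarrow> M $$ (\<tau> k, k) \<noteq> 0"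
  shows "balanced r n (level_subset.time r n (w ` {..<r})) B"
proof -
  let ?A = "w ` {..<r}"
  note perm = NC_permutes[OF w]
  have inj: "w k = w l \<longleftrightarrow> k = l" for k l using permutes_inj[OF perm] by (auto dest: injD)
  have winv: "Hilbert_Choice.inv w (w k) = k" for k using NC_inv_eq[OF w] by simp
  interpret level_subset r n ?A
    by (rule level_subset_NC_image[OF w rn])
  have entry: "\<tau> k = w k \<or> (\<tau> k, w k) \<in> Inv_NC n w" if k: "k < r" for k
  proof (rule ccontr)
    assume *: "\<not> ?thesis"
    have "(\<tau> k, k) \<notin> {(i, Hilbert_Choice.inv w j) |i j. (i, j) \<in> Inv_NC n w}"
    proof
      assume "(\<tau> k, k) \<in> {(i, Hilbert_Choice.inv w j) |i j. (i, j) \<in> Inv_NC n w}"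
      then obtain j where "k = Hilbert_Choice.inv w j" "(\<tau> k, j) \<in> Inv_NC n w" by blast
      then show False using * NC_inv_eq[OF w, of j k] by simp
    qed
    moreover have "\<tau> k < n" using \<tau>(1,2) k by (auto simp: bij_betw_def)
    ultimately have "M $$ (\<tau> k, k) = 0"
      using M k rn * unfolding nc_matrices_def by auto
    then show False using \<tau>(3)[OF k] by simp
  qed
  define \<rho> where "\<rho> j = \<tau> (Hilbert_Choice.inv w j)" for j
  have \<rho>w: "\<rho> (w k) = \<tau> k" for k by (simp add: \<rho>_def winv)
  have \<tau>inj: "k = l" if "\<tau> k = \<tau> l" "k < r" "l < r" for k l
    using \<tau>(1) that by (auto simp: bij_betw_def dest: inj_onD)
  have "inj_on \<rho> ?A" by (rule inj_onI) (auto simp: \<rho>w dest: \<tau>inj)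
  moreover have "\<rho> j = j \<or> (\<rho> j < j \<and> \<rho> j \<notin> ?A \<and> close_levels r ?A (\<rho> j) j)" if j: "j \<in> ?A" for j
  proof -
    obtain k where k: "k < r" "j = w k" using j by auto
    show ?thesis
    proof (cases "\<tau> k = w k")
      case True
      then show ?thesis using k \<rho>w by simp
    next
      case False
      define i where "i = \<tau> k"
      have ij: "(i, j) \<in> Inv_NC n w" using entry[OF k(1)] False k by (simp add: i_def)
      let ?a = "Hilbert_Choice.inv w i"
      have "kreweras_pair n w (Transposition.transpose i j \<circ> w) i j ?a k"
        using Inv_NC_kreweras_pair[OF w ij] k winv by simp
      then interpret kreweras_pair n r w "Transposition.transpose i j \<circ> w" i j ?a k .
      \<comment> \<open>If the pivot \<open>i\<close> belonged to a column \<open>?a < r\<close>,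
        that column could not use row \<open>i\<close>, already taken by column \<open>k\<close>. It
        would use an inversion \<open>(\<tau> ?a, i)\<close>, for which \<open>b_le\<close> gives
        \<open>?a \<le> i\<close>, against \<open>i_less\<close>.\<close>
      have "r \<le> ?a"
      proof (rule ccontr)
        assume "\<not> r \<le> ?a"
        then have a: "?a < r" by simp
        have "\<tau> ?a \<noteq> w ?a"
        proof
          assume "\<tau> ?a = w ?a"
          then have "\<tau> ?a = \<tau> k" using ij(3) by (simp add: i_def)
          then have "?a = k" using \<tau>inj a k by blast
          then show False using ba by simp
        qed
        then have "(\<tau> ?a, i) \<in> Inv_NC n w" using entry[OF a] ij(3) by simp
        then interpret up: kreweras_pair n r w "Transposition.transpose (\<tau> ?a) i \<circ> w" "\<tau> ?a" i
          "Hilbert_Choice.inv w (\<tau> ?a)" ?a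
          using Inv_NC_kreweras_pair[OF w] by simp
        show False using up.b_le i_less by simp
      qed
      moreover from this have "i \<notin> ?A" using ij(3) inj by (auto simp: not_less[symmetric])
      ultimately show ?thesis
        using close[OF k(1) _ rn] ij(1) k(2) by (simp add: \<rho>w i_def)
    qed
  qed
  ultimately have "balanced r n time (\<rho> ` ?A)" by (rule balanced_exchange)
  moreover have "\<rho> ` ?A = B"
    using \<tau>(1) by (auto simp: image_image \<rho>w bij_betw_def)
  ultimately show ?thesis by simp
qed

text \<open>Balance refers to the chain of \<open>w [r]\<close>, the resulting closeness to the
  levels of \<open>A\<close> itself. As closeness is formulated for exchanges that move downwards,
  the case \<open>j < i\<close> is read backwards from the other set.\<close>

lemma balanced_edge:
  assumes w: "w \<in> NC n" and rn: "r \<le> n"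
    and A: "A \<subseteq> {..<n}" "card A = r" and ij: "i \<notin> A" "j \<in> A" "i < n"
    and bal: "balanced r n (level_subset.time r n (w ` {..<r})) A"
      "balanced r n (level_subset.time r n (w ` {..<r})) (insert i (A - {j}))"
  shows "{A, insert i (A - {j})} \<in> quasisymmetric_johnson_edges r n"
proof -
  let ?B = "insert i (A - {j})"
  interpret W: level_subset r n "w ` {..<r}"
    by (rule level_subset_NC_image[OF w rn])
  interpret LA: level_subset r n A using A rn by unfold_locales
  interpret LB: level_subset r n ?B
  proof
    show "?B \<subseteq> {..<n}" using A ij by blast
    show "card ?B = r" by (rule LA.exchange_card[OF ij(1,2)])
  qed (rule rn)
  interpret chain r n W.time by (rule W.chain_time)
  have "i \<noteq> j" using ij by auto
  then consider "i < j" | "j < i" by linarith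
  then show ?thesis
  proof cases
    case 1
    then show ?thesis using LA.close_imp_edge[OF ij(1,2) 1] balanced_close[OF bal(1) A(1) bal(2) ij(1,2) 1] by simp
  next
    case 2
    have restore: "insert j (?B - {i}) = A" using ij by auto
    have "j \<notin> ?B" "i \<in> ?B" using \<open>i \<noteq> j\<close> by auto
    then have "{?B, insert j (?B - {i})} \<in> quasisymmetric_johnson_edges r n"
      using LB.close_imp_edge[of j i] balanced_close[of ?B j i] bal 2 restore LB.A(1) by simp
    then show ?thesis using restore by (simp add: insert_commute)
  qed
qed

section \<open>Minors of full rank matrices\<close>

lemma cspan_cols:
  assumes "M \<in> carrier_mat n r"
  shows "cspan n (set (cols M)) = {M *\<^sub>v c | c. c \<in> carrier_vec r}"
proof -
  interpret vec_space "TYPE(complex)" n .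
  show ?thesis
    using col_space_eq[OF assms] assms unfolding col_space_def by auto
qed

text \<open>Linear independence of the set of columns does not see repetitions, so each direction
  first shows that the columns are distinct.\<close>

lemma full_rank_iff_inj:
  fixes M :: "complex mat"
  assumes M: "M \<in> carrier_mat n r"
  shows "vec_space.rank n M = r \<longleftrightarrow> (\<forall>c\<in>carrier_vec r. M *\<^sub>v c = 0\<^sub>v n \<longrightarrow> c = 0\<^sub>v r)"
proof -
  interpret vec_space "TYPE(complex)" n .
  have sub: "set (cols M) \<subseteq> carrier_vec n" using M cols_dim by blast
  show ?thesis
  proof
    assume rank: "rank M = r"
    have dist: "distinct (cols M)"
    proof -
      obtain S where S: "maximal S (\<lambda>T. T \<subseteq> set (cols M) \<and> lin_indpt T)"
        using maximal_exists[of "\<lambda>T. T \<subseteq> set (cols M) \<and> lin_indpt T" "card (set (cols M))" "{}"]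
        by (meson List.finite_set card_mono empty_iff empty_subsetI finite_lin_indpt2 rev_finite_subset)
      then have "card S = r" "S \<subseteq> set (cols M)"
        using rank_card_indpt[OF M S] rank by (auto simp: maximal_def)
      then have "r \<le> card (set (cols M))" using card_mono[of "set (cols M)" S] by simp
      moreover have "length (cols M) = r" using M by simp
      ultimately show ?thesis using card_length[of "cols M"] card_distinct[of "cols M"] by simp
    qed
    show "\<forall>c\<in>carrier_vec r. M *\<^sub>v c = 0\<^sub>v n \<longrightarrow> c = 0\<^sub>v r"
      using lin_depI[OF M _ _ _ dist] full_rank_lin_indpt[OF M rank dist] by blast
  next
    assume inj: "\<forall>c\<in>carrier_vec r. M *\<^sub>v c = 0\<^sub>v n \<longrightarrow> c = 0\<^sub>v r"
    have dist: "distinct (cols M)"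
      unfolding distinct_conv_nth
    proof (intro allI impI notI)
      fix i j assume ij: "i < length (cols M)" "j < length (cols M)" "i \<noteq> j" "cols M ! i = cols M ! j"
      then have r: "i < r" "j < r" using M by auto
      let ?c = "unit_vec r i - unit_vec r j :: complex vec"
      have "M *\<^sub>v ?c = col M i - col M j"
      proof -
        have "M *\<^sub>v unit_vec r k = col M k" if "k < r" for k
          using M that by (intro eq_vecI) (auto simp: scalar_prod_right_unit)
        then show ?thesis
          using r mult_minus_distrib_mat_vec[OF M, of "unit_vec r i" "unit_vec r j"] by simp
      qed
      also have "\<dots> = 0\<^sub>v n" using ij M r by auto
      finally have "?c = 0\<^sub>v r" using inj by auto
      then have "?c $ i = 0" using r by simp
      then show False using r ij(3) by simp
    qed
    have "lin_indpt (set (cols M))"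
    proof
      assume "lin_dep (set (cols M))"
      then obtain v where "v \<in> carrier_vec r" "v \<noteq> 0\<^sub>v r" "M *\<^sub>v v = 0\<^sub>v n"
        using lin_depE[OF M _ dist] by blast
      then show False using inj by blast
    qed
    then show "rank M = r" by (rule lin_indpt_full_rank[OF M dist])
  qed
qed

lemma plucker_rep_Gr:
  assumes "plucker_rep r n W M"
  shows "W \<in> Gr r n"
proof -
  interpret vec_space "TYPE(complex)" n .
  have M: "M \<in> carrier_mat n r" "rank M = r" "W = span (set (cols M))"
    using assms by (auto simp: plucker_rep_def)
  have "set (cols M) \<subseteq> carrier_vec n" using M cols_dim by blast
  then have "VectorSpace.subspace class_ring W V" unfolding M(3) by (rule span_is_subspace)
  then show ?thesis using M by (simp add: Gr_def rank_def)
qed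

section \<open>Minors with prescribed rows\<close>

locale row_selection =
  fixes n r :: nat and M :: "complex mat" and B :: "nat set"
  assumes M_carrier: "M \<in> carrier_mat n r" and B_rows: "B \<subseteq> {..<n}" "card B = r"
begin

lemma card_rows: "card {i. i < dim_row M \<and> i \<in> B} = r"
proof -
  have "{i. i < dim_row M \<and> i \<in> B} = B" using M_carrier B_rows by auto
  then show ?thesis using B_rows by simp
qed

lemma card_cols: "card {j. j < dim_col M \<and> j \<in> UNIV} = r" using M_carrier by simp

lemma finite_B: "finite B" using B_rows(1) finite_subset by blast

lemma submatrix_carrier: "submatrix M B UNIV \<in> carrier_mat r r"
  using dim_submatrix[of M B UNIV] card_rows card_cols by auto

lemma submatrix_entry: "a < r \<Longrightarrow> k < r \<Longrightarrow> submatrix M B UNIV $$ (a, k) = M $$ (pick B a, k)"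
  using submatrix_index[of a M B k UNIV] card_rows card_cols pick_UNIV by simp

lemma pick_bij: "bij_betw (pick B) {..<r} B"
proof -
  have "pick B a < pick B b" if "a < b" "b < r" for a b
    using pick_mono_le[of b B a] that B_rows by simp
  then have "inj_on (pick B) {..<r}"
    by (intro inj_onI) (metis less_irrefl lessThan_iff linorder_neqE_nat)
  moreover have "pick B ` {..<r} \<subseteq> B" using pick_in_set_le B_rows by auto
  ultimately show ?thesis
    using card_image[of "pick B" "{..<r}"] B_rows finite_B by (simp add: bij_betw_def card_subset_eq)
qed

lemma pick_lt: "a < r \<Longrightarrow> pick B a < n"
  using pick_bij B_rows by (auto simp: bij_betw_def)

lemma submatrix_mult_vec:
  assumes "a < r" "c \<in> carrier_vec r"
  shows "(submatrix M B UNIV *\<^sub>v c) $ a = (M *\<^sub>v c) $ (pick B a)"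
proof -
  have "row (submatrix M B UNIV) a = row M (pick B a)"
    using row_submatrix_UNIV[of a M B] assms(1) card_rows by simp
  then show ?thesis using assms(1) pick_lt[OF assms(1)] submatrix_carrier M_carrier by simp
qed

text \<open>Vanishing of a minor becomes a statement about kernel vectors, which allows minors of
  neighbouring sets to be compared without determinant identities.\<close>

lemma plucker_eq_0_iff:
  "plucker M B = 0 \<longleftrightarrow> (\<exists>c\<in>carrier_vec r. c \<noteq> 0\<^sub>v r \<and> (\<forall>b\<in>B. (M *\<^sub>v c) $ b = 0))"
proof -
  have "submatrix M B UNIV *\<^sub>v c = 0\<^sub>v r \<longleftrightarrow> (\<forall>b\<in>B. (M *\<^sub>v c) $ b = 0)" if c: "c \<in> carrier_vec r" for c
  proof -
    have "submatrix M B UNIV *\<^sub>v c = 0\<^sub>v r \<longleftrightarrow> (\<forall>a<r. (submatrix M B UNIV *\<^sub>v c) $ a = 0)"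
      using submatrix_carrier by (auto simp: vec_eq_iff)
    also have "\<dots> \<longleftrightarrow> (\<forall>a\<in>{..<r}. (M *\<^sub>v c) $ (pick B a) = 0)"
      using submatrix_mult_vec[OF _ c] by auto
    also have "\<dots> \<longleftrightarrow> (\<forall>b\<in>pick B ` {..<r}. (M *\<^sub>v c) $ b = 0)" by blast
    also have "pick B ` {..<r} = B" using pick_bij by (simp add: bij_betw_def)
    finally show ?thesis .
  qed
  then show ?thesis
    unfolding plucker_def det_0_iff_vec_prod_zero_field[OF submatrix_carrier] by blast
qed

text \<open>The coefficients are columns of the inverse of the submatrix; the vectors
  \<open>M *\<^sub>v c j\<close> for \<open>j \<in> B\<close> form the basis of the column space
  reduced at \<open>B\<close>.\<close>

lemma dual_coefficients:
  assumes nz: "plucker M B \<noteq> 0"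
  obtains c where "\<And>j. c j \<in> carrier_vec r"
    "\<And>j b. j \<in> B \<Longrightarrow> b \<in> B \<Longrightarrow> (M *\<^sub>v c j) $ b = (if b = j then 1 else 0)"
proof -
  let ?S = "submatrix M B UNIV"
  obtain K where K: "K \<in> carrier_mat r r" "?S * K = 1\<^sub>m r"
    using det_non_zero_imp_unit[OF submatrix_carrier, of "()"] nz
    by (auto simp: Units_def ring_mat_simps plucker_def)
  define idx where "idx = inv_into {..<r} (pick B)"
  have idx: "idx b < r" "pick B (idx b) = b" if "b \<in> B" for b
    using that pick_bij by (auto simp: idx_def bij_betw_def intro: f_inv_into_f)
      (metis inv_into_into lessThan_iff)
  define c where "c j = K *\<^sub>v unit_vec r (idx j)" for j
  have carr: "c j \<in> carrier_vec r" for j using K by (simp add: c_def)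
  have "(M *\<^sub>v c j) $ b = (if b = j then 1 else 0)" if jb: "j \<in> B" "b \<in> B" for j b
  proof -
    have "(M *\<^sub>v c j) $ b = (?S *\<^sub>v c j) $ (idx b)"
      using submatrix_mult_vec[OF idx(1)[OF jb(2)] carr[of j]] idx(2)[OF jb(2)] by simp
    also have "?S *\<^sub>v c j = (?S * K) *\<^sub>v unit_vec r (idx j)"
      unfolding c_def by (rule assoc_mult_mat_vec[symmetric, OF submatrix_carrier K(1)]) simp
    also have "\<dots> = unit_vec r (idx j)" using K(2) by simp
    also have "unit_vec r (idx j) $ (idx b) = (if idx b = idx j then 1 else (0 :: complex))"
      using idx(1)[OF jb(1)] idx(1)[OF jb(2)] by simp
    also have "idx b = idx j \<longleftrightarrow> b = j" using idx(2)[OF jb(1)] idx(2)[OF jb(2)] by metis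
    finally show ?thesis .
  qed
  then show ?thesis using that carr by blast
qed

lemma plucker_mult:
  assumes G: "G \<in> carrier_mat r r"
  shows "plucker (M * G) B = plucker M B * det G"
proof -
  interpret MG: row_selection n r "M * G" B using M_carrier G B_rows by unfold_locales auto
  have "submatrix (M * G) B UNIV = submatrix M B UNIV * G"
  proof (rule eq_matI)
    fix a k assume "a < dim_row (submatrix M B UNIV * G)" "k < dim_col (submatrix M B UNIV * G)"
    then have ak: "a < r" "k < r" using submatrix_carrier G by auto
    have "row (submatrix M B UNIV) a = row M (pick B a)"
      using row_submatrix_UNIV[of a M B] ak card_rows by simp
    then show "submatrix (M * G) B UNIV $$ (a, k) = (submatrix M B UNIV * G) $$ (a, k)"
      using MG.submatrix_entry[OF ak] ak pick_lt[OF ak(1)] submatrix_carrier M_carrier G by simp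
  qed (use MG.submatrix_carrier submatrix_carrier G in auto)
  then show ?thesis
    unfolding plucker_def using det_mult[OF submatrix_carrier G] by simp
qed

lemma plucker_nonzero_matching:
  assumes "plucker M B \<noteq> 0"
  obtains \<tau> where "bij_betw \<tau> {..<r} B" "\<And>k. k < r \<Longrightarrow> M $$ (\<tau> k, k) \<noteq> 0"
proof -
  let ?S = "submatrix M B UNIV"
  have "(\<Sum>p | p permutes {0..<r}. signof p * (\<Prod>i = 0..<r. ?S $$ (i, p i))) \<noteq> 0"
    using assms det_def'[OF submatrix_carrier] by (simp add: plucker_def)
  then obtain p where p: "p permutes {0..<r}" and nz: "signof p * (\<Prod>i = 0..<r. ?S $$ (i, p i)) \<noteq> 0"
    using sum.not_neutral_contains_not_neutral by blast
  from nz have nz': "?S $$ (i, p i) \<noteq> 0" if "i < r" for i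
    using that by (auto simp: prod_zero_iff)
  \<comment> \<open>The expansion runs over rows; the inverse permutation indexes the chosen entries
    by columns.\<close>
  let ?q = "Hilbert_Choice.inv p"
  have q: "bij_betw ?q {..<r} {..<r}"
    using permutes_imp_bij[OF permutes_inv[OF p]] by (simp add: atLeast0LessThan)
  have "M $$ ((pick B \<circ> ?q) k, k) \<noteq> 0" if "k < r" for k
  proof -
    have "?q k < r" "p (?q k) = k" using q that permutes_inverses[OF p] by (auto simp: bij_betw_def)
    then show ?thesis using nz'[of "?q k"] submatrix_entry[of "?q k" k] that by simp
  qed
  then show ?thesis using that bij_betw_trans[OF q pick_bij] by blast
qed

end

section \<open>Column spaces, invertibility and nonvanishing minors\<close>

lemma plucker_rep_factor:
  assumes M: "M \<in> carrier_mat n r" and M': "M' \<in> carrier_mat n r"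
    and sub: "set (cols M') \<subseteq> cspan n (set (cols M))"
  obtains G where "G \<in> carrier_mat r r" "M' = M * G"
proof -
  have "\<exists>g. g \<in> carrier_vec r \<and> col M' k = M *\<^sub>v g" if "k < r" for k
  proof -
    have "col M' k \<in> set (cols M')" using that M' by (auto simp: cols_def)
    then show ?thesis using sub cspan_cols[OF M] by auto
  qed
  then obtain g where g: "\<And>k. k < r \<Longrightarrow> g k \<in> carrier_vec r \<and> col M' k = M *\<^sub>v g k" by metis
  define G where "G = mat r r (\<lambda>(i, k). g k $ i)"
  have G: "G \<in> carrier_mat r r" by (simp add: G_def)
  have colG: "col G k = g k" if "k < r" for k
    using that g[OF that] by (auto simp: G_def)
  have "M' = M * G"
  proof (rule eq_matI)
    fix i k assume "i < dim_row (M * G)" "k < dim_col (M * G)"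
    then have ik: "i < n" "k < r" using M G by auto
    have "M' $$ (i, k) = col M' k $ i" using ik M' by simp
    also have "\<dots> = (M * G) $$ (i, k)" using g[OF ik(2)] colG[OF ik(2)] ik M G by simp
    finally show "M' $$ (i, k) = (M * G) $$ (i, k)" .
  qed (use M M' G in auto)
  then show ?thesis using that G by blast
qed

lemma left_columns:
  assumes M: "M \<in> carrier_mat n m" and r: "r \<le> m"
  shows "set (take r (cols M)) = set (cols (mat n r (\<lambda>(i, k). M $$ (i, k))))"
proof -
  have "take r (cols M) = cols (mat n r (\<lambda>(i, k). M $$ (i, k)))"
    by (rule nth_equalityI) (use M r in \<open>auto simp: cols_nth\<close>)
  then show ?thesis by simp
qed

lemma invertible_inj:
  fixes N :: "complex mat"
  assumes N: "N \<in> carrier_mat n n"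
  shows "invertible_mat N \<longleftrightarrow> (\<forall>c\<in>carrier_vec n. N *\<^sub>v c = 0\<^sub>v n \<longrightarrow> c = 0\<^sub>v n)"
proof
  assume "invertible_mat N"
  then obtain B where B: "N * B = 1\<^sub>m n" "B * N = 1\<^sub>m (dim_row B)"
    using N by (auto simp: invertible_mat_def inverts_mat_def)
  have "dim_col B = dim_col (1\<^sub>m n :: complex mat)" "dim_row B = dim_col (1\<^sub>m (dim_row B) :: complex mat)"
    using B(1) by (metis index_mult_mat(3), simp)
  moreover have "dim_row B = n" using arg_cong[OF B(2), of dim_col] N by simp
  ultimately have Bc: "B \<in> carrier_mat n n" by auto
  show "\<forall>c\<in>carrier_vec n. N *\<^sub>v c = 0\<^sub>v n \<longrightarrow> c = 0\<^sub>v n"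
  proof (intro ballI impI)
    fix c :: "complex vec" assume c: "c \<in> carrier_vec n" "N *\<^sub>v c = 0\<^sub>v n"
    have "c = (B * N) *\<^sub>v c" using B(2) Bc c by simp
    also have "\<dots> = B *\<^sub>v (N *\<^sub>v c)" using Bc N c(1) by simp
    also have "\<dots> = 0\<^sub>v n" using c(2) Bc by (intro eq_vecI) auto
    finally show "c = 0\<^sub>v n" .
  qed
next
  assume "\<forall>c\<in>carrier_vec n. N *\<^sub>v c = 0\<^sub>v n \<longrightarrow> c = 0\<^sub>v n"
  then have "det N \<noteq> 0" using det_0_iff_vec_prod_zero_field[OF N] by blast
  then obtain B where "B \<in> carrier_mat n n" "N * B = 1\<^sub>m n" "B * N = 1\<^sub>m n"
    using det_non_zero_imp_unit[OF N, of "()"] by (auto simp: Units_def ring_mat_simps)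
  then show "invertible_mat N"
    using N by (auto simp: invertible_mat_def inverts_mat_def)
qed

lemma left_columns_inj:
  fixes N :: "complex mat"
  assumes N: "N \<in> carrier_mat n n" "invertible_mat N" and r: "r \<le> n"
  shows "vec_space.rank n (mat n r (\<lambda>(i, k). N $$ (i, k))) = r"
proof -
  let ?N = "mat n r (\<lambda>(i, k). N $$ (i, k))"
  have carr: "?N \<in> carrier_mat n r" by simp
  have "c = 0\<^sub>v r" if c: "c \<in> carrier_vec r" "?N *\<^sub>v c = 0\<^sub>v n" for c
  proof -
    \<comment> \<open>Padding by zeros carries a kernel vector of the left columns to one of
      \<open>N\<close>.\<close>
    define d where "d = vec n (\<lambda>k. if k < r then c $ k else 0)"
    have "N *\<^sub>v d = ?N *\<^sub>v c"
    proof (rule eq_vecI)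
      fix i assume "i < dim_vec (?N *\<^sub>v c)"
      then have i: "i < n" by simp
      have "(N *\<^sub>v d) $ i = (\<Sum>k = 0..<n. N $$ (i, k) * (if k < r then c $ k else 0))"
        using i N by (simp add: scalar_prod_def d_def)
      also have "\<dots> = (\<Sum>k = 0..<r. N $$ (i, k) * c $ k)"
        using r by (intro sum.mono_neutral_cong_right) auto
      also have "\<dots> = (?N *\<^sub>v c) $ i" 
        using i c(1) by (auto simp: scalar_prod_def intro!: sum.cong)
      finally show "(N *\<^sub>v d) $ i = (?N *\<^sub>v c) $ i" .
    qed (use N in simp)
    then have "d = 0\<^sub>v n" using c N invertible_inj[OF N(1)] by (simp add: d_def)
    then have "c $ k = 0" if "k < r" for k
    proof -
      have "d $ k = c $ k" using that r by (simp add: d_def)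
      then show ?thesis using \<open>d = 0\<^sub>v n\<close> that r by simp
    qed
    then show ?thesis using c by (intro eq_vecI) auto
  qed
  then show ?thesis using full_rank_iff_inj[OF carr] by blast
qed

text \<open>Fewer than \<open>r\<close> linear conditions on \<open>r\<close> unknowns: the selected
  rows are padded with zero rows to a square matrix of determinant \<open>0\<close>.\<close>

lemma ex_kernel_vec:
  fixes M :: "complex mat"
  assumes M: "M \<in> carrier_mat n r" and B: "B \<subseteq> {..<n}" "card B < r"
  obtains c where "c \<in> carrier_vec r" "c \<noteq> 0\<^sub>v r" "\<And>b. b \<in> B \<Longrightarrow> (M *\<^sub>v c) $ b = 0"
proof -
  have "finite B" using B(1) finite_subset by blast
  then obtain f where f: "bij_betw f {..<card B} B"
    using ex_bij_betw_nat_finite[of B] by (auto simp: atLeast0LessThan)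
  define E where "E = mat r r (\<lambda>(a, k). if a < card B then M $$ (f a, k) else 0)"
  have E: "E \<in> carrier_mat r r" by (simp add: E_def)
  have "(\<Prod>i = 0..<r. E $$ (i, p i)) = 0" if "p permutes {0..<r}" for p
  proof -
    have "p (card B) < r" using permutes_in_image[OF that, of "card B"] B(2) by simp
    then have "E $$ (card B, p (card B)) = 0" using B(2) by (simp add: E_def)
    then show ?thesis using B(2) by (auto simp: prod_zero_iff)
  qed
  then have "det E = 0" unfolding det_def'[OF E] by (intro sum.neutral) auto
  then obtain c where c: "c \<in> carrier_vec r" "c \<noteq> 0\<^sub>v r" "E *\<^sub>v c = 0\<^sub>v r"
    using det_0_iff_vec_prod_zero_field[OF E] by blast
  have "(M *\<^sub>v c) $ b = 0" if b: "b \<in> B" for b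
  proof -
    have "b \<in> f ` {..<card B}" using f b by (simp add: bij_betw_def)
    then obtain a where a: "a < card B" "f a = b" by auto
    have "row E a = row M b" using a b B M by (intro eq_vecI) (auto simp: E_def)
    then have "(M *\<^sub>v c) $ b = (E *\<^sub>v c) $ a" using a b B M E by auto
    then show ?thesis using c(3) a B(2) by simp
  qed
  then show ?thesis using that c by blast
qed

text \<open>Gaussian elimination as an induction: pivot rows are added one at a time, together with
  vectors dual to them, and \<open>r\<close> dual vectors invert the submatrix.\<close>

lemma ex_nonzero_plucker:
  fixes M :: "complex mat"
  assumes M: "M \<in> carrier_mat n r"
    and inj: "\<forall>c\<in>carrier_vec r. M *\<^sub>v c = 0\<^sub>v n \<longrightarrow> c = 0\<^sub>v r"
  shows "\<exists>B\<in>subsets_of_size r n. plucker M B \<noteq> 0"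
proof -
  have "\<exists>B c. B \<subseteq> {..<n} \<and> card B = k \<and> (\<forall>a\<in>B. c a \<in> carrier_vec r \<and>
      (\<forall>b\<in>B. (M *\<^sub>v c a) $ b = (if b = a then 1 else 0)))" if "k \<le> r" for k
    using that
  proof (induction k)
    case 0
    then show ?case by (intro exI[of _ "{}"]) simp
  next
    case (Suc k)
    then obtain B c where B: "B \<subseteq> {..<n}" "card B = k" and c: "\<And>a. a \<in> B \<Longrightarrow> c a \<in> carrier_vec r"
      "\<And>a b. a \<in> B \<Longrightarrow> b \<in> B \<Longrightarrow> (M *\<^sub>v c a) $ b = (if b = a then 1 else 0)"
      by (metis Suc_leD)
    have finB: "finite B" using B(1) finite_subset by blast
    \<comment> \<open>A direction vanishing on the old pivot rows; injectivity of \<open>M\<close>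
      supplies a new pivot row where it does not vanish.\<close>
    obtain d where d: "d \<in> carrier_vec r" "d \<noteq> 0\<^sub>v r" "\<And>b. b \<in> B \<Longrightarrow> (M *\<^sub>v d) $ b = 0"
      using ex_kernel_vec[OF M B(1)] B(2) Suc.prems by auto
    have "M *\<^sub>v d \<noteq> 0\<^sub>v n" using inj d by blast
    then obtain i where i: "i < n" "(M *\<^sub>v d) $ i \<noteq> 0"
      using M by (metis eq_vecI carrier_matD(1) dim_mult_mat_vec index_zero_vec)
    have iB: "i \<notin> B" using d(3) i by blast
    define e where "e = (1 / (M *\<^sub>v d) $ i) \<cdot>\<^sub>v d"
    have Me: "(M *\<^sub>v e) $ b = (1 / (M *\<^sub>v d) $ i) * (M *\<^sub>v d) $ b" if "b < n" for b
      unfolding e_def mult_mat_vec[OF M d(1)] using that M by (intro index_smult_vec) simp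
    have e: "e \<in> carrier_vec r" "(M *\<^sub>v e) $ i = 1" "\<And>b. b \<in> B \<Longrightarrow> (M *\<^sub>v e) $ b = 0"
    proof -
      show "e \<in> carrier_vec r" using d(1) by (simp add: e_def)
      show "(M *\<^sub>v e) $ i = 1" 
        unfolding Me[OF i(1)] times_divide_eq_left mult_1 using i(2) by (rule divide_self)
      show "(M *\<^sub>v e) $ b = 0" if "b \<in> B" for b
      proof -
        have "b < n" using that B(1) by auto
        then show ?thesis using Me d(3)[OF that] by (simp only: mult_zero_right)
      qed
    qed
    \<comment> \<open>Clears the new pivot row in the old dual vectors; their entries in the old
      rows stay, since \<open>M *\<^sub>v e\<close> vanishes there.\<close>
    define c' where "c' a = (if a = i then e else c a - ((M *\<^sub>v c a) $ i) \<cdot>\<^sub>v e)" for a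
    have "c' a \<in> carrier_vec r \<and> (\<forall>b\<in>insert i B. (M *\<^sub>v c' a) $ b = (if b = a then 1 else 0))"
      if a: "a \<in> insert i B" for a
    proof (cases "a = i")
      case True
      then show ?thesis using e iB by (auto simp: c'_def)
    next
      case False
      then have aB: "a \<in> B" using a by simp
      have Mc': "M *\<^sub>v c' a = M *\<^sub>v c a - ((M *\<^sub>v c a) $ i) \<cdot>\<^sub>v (M *\<^sub>v e)"
        using False mult_minus_distrib_mat_vec[OF M c(1)[OF aB], of "((M *\<^sub>v c a) $ i) \<cdot>\<^sub>v e"]
          mult_mat_vec[OF M e(1)] e(1) by (simp add: c'_def)
      have "(M *\<^sub>v c' a) $ b = (if b = a then 1 else 0)" if b: "b \<in> insert i B" for b
      proof -
        have "b < n" using b i B by auto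
        then have "(M *\<^sub>v c' a) $ b = (M *\<^sub>v c a) $ b - (M *\<^sub>v c a) $ i * (M *\<^sub>v e) $ b"
          unfolding Mc' using M by simp
        then show ?thesis using b c(2)[OF aB, of b] e False aB iB by (cases "b = i") auto
      qed
      moreover have "c' a \<in> carrier_vec r" using c(1)[OF aB] e(1) False by (simp add: c'_def)
      ultimately show ?thesis by blast
    qed
    moreover have "insert i B \<subseteq> {..<n}" "card (insert i B) = Suc k" using i iB B finB by auto
    ultimately show ?case by blast
  qed
  then obtain B c where B: "B \<subseteq> {..<n}" "card B = r" and c: "\<And>a. a \<in> B \<Longrightarrow> c a \<in> carrier_vec r"
    "\<And>a b. a \<in> B \<Longrightarrow> b \<in> B \<Longrightarrow> (M *\<^sub>v c a) $ b = (if b = a then 1 else 0)"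
    by (metis order_refl)
  interpret row_selection n r M B using M B by unfold_locales
  define C where "C = mat r r (\<lambda>(i, k). c (pick B k) $ i)"
  have C: "C \<in> carrier_mat r r" by (simp add: C_def)
  have pick: "pick B a \<in> B" if "a < r" for a using pick_bij that by (auto simp: bij_betw_def)
  have pick_eq: "pick B a = pick B k \<longleftrightarrow> a = k" if "a < r" "k < r" for a k
    using pick_bij that by (auto simp: bij_betw_def dest: inj_onD)
  have "submatrix M B UNIV * C = 1\<^sub>m r"
  proof (rule eq_matI)
    fix a k assume "a < dim_row (1\<^sub>m r :: complex mat)" "k < dim_col (1\<^sub>m r :: complex mat)"
    then have ak: "a < r" "k < r" by auto
    have col: "col C k = c (pick B k)" using c(1)[OF pick[OF ak(2)]] ak by (intro eq_vecI) (auto simp: C_def)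
    have "(submatrix M B UNIV * C) $$ (a, k) = (submatrix M B UNIV *\<^sub>v c (pick B k)) $ a"
      using ak submatrix_carrier C col by simp
    also have "\<dots> = (M *\<^sub>v c (pick B k)) $ (pick B a)"
      by (rule submatrix_mult_vec[OF ak(1) c(1)[OF pick[OF ak(2)]]])
    also have "\<dots> = (if a = k then 1 else 0)"
      using c(2)[OF pick[OF ak(2)] pick[OF ak(1)]] pick_eq[OF ak] by simp
    finally show "(submatrix M B UNIV * C) $$ (a, k) = 1\<^sub>m r $$ (a, k)" using ak by simp
  qed (use submatrix_carrier C in auto)
  then have "det (submatrix M B UNIV) * det C = 1"
    using det_mult[OF submatrix_carrier C] by simp
  then have "plucker M B \<noteq> 0" by (auto simp: plucker_def)
  then show ?thesis using B by (auto simp: subsets_of_size_def)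
qed

text \<open>With columns ordered by their pivots the matrix is unitriangular: off-pivot nonzero
  entries lie above the pivot. In a kernel vector, a nonzero coordinate with the largest pivot row
  would survive in that row.\<close>

lemma nc_matrix_invertible:
  assumes w: "w \<in> NC n" and M: "M \<in> nc_matrices n w"
  shows "invertible_mat M"
proof -
  have Mc: "M \<in> carrier_mat n n" using M by (simp add: nc_matrices_def)
  note perm = NC_permutes[OF w]
  have lt: "w k < n" if "k < n" for k using permutes_in_image[OF perm, of k] that by simp
  have upper: "i < w k" if "i < n" "k < n" "M $$ (i, k) \<noteq> 0" "i \<noteq> w k" for i k
  proof -
    have "(i, k) \<in> {(i, Hilbert_Choice.inv w j) |i j. (i, j) \<in> Inv_NC n w}"
    proof (rule ccontr)
      assume "\<not> ?thesis"
      then have "M $$ (i, k) = 0" using M that(1,2,4) unfolding nc_matrices_def by blast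
      then show False using that(3) by simp
    qed
    then obtain j where j: "k = Hilbert_Choice.inv w j" "(i, j) \<in> Inv_NC n w" by blast
    then have "w k = j" using NC_inv_eq[OF w, of j k] by simp
    then show ?thesis using j(2) by (auto simp: Inv_NC_def Inv_def)
  qed
  have "c = 0\<^sub>v n" if c: "c \<in> carrier_vec n" "M *\<^sub>v c = 0\<^sub>v n" for c
  proof (rule ccontr)
    assume "c \<noteq> 0\<^sub>v n"
    define K where "K = {k. k < n \<and> c $ k \<noteq> 0}"
    have "K \<noteq> {}" using \<open>c \<noteq> 0\<^sub>v n\<close> c(1) by (auto simp: K_def intro: eq_vecI)
    moreover have "finite K" by (simp add: K_def)
    ultimately obtain k where k: "k \<in> K" and max: "\<And>l. l \<in> K \<Longrightarrow> w l \<le> w k"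
      using Max_in[of "w ` K"] Max_ge[of "w ` K"] by (metis (no_types, lifting) finite_imageI image_iff image_is_empty)
    have kn: "k < n" using k by (simp add: K_def)
    have zero: "M $$ (w k, l) * c $ l = 0" if l: "l < n" "l \<noteq> k" for l
    proof (rule ccontr)
      assume nz: "M $$ (w k, l) * c $ l \<noteq> 0"
      then have "w l \<le> w k" using max[of l] l by (simp add: K_def)
      moreover have "w k \<noteq> w l" using l permutes_inj[OF perm] by (auto dest: injD)
      ultimately show False using upper[of "w k" l] nz l lt[OF kn] by auto
    qed
    have "(M *\<^sub>v c) $ (w k) = (\<Sum>l = 0..<n. M $$ (w k, l) * c $ l)"
      using Mc c(1) lt[OF kn] by (auto simp: scalar_prod_def intro!: sum.cong)
    also have "\<dots> = (\<Sum>l\<in>{k}. M $$ (w k, l) * c $ l)"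
      using kn zero by (intro sum.mono_neutral_right) auto
    also have "\<dots> = c $ k" using M kn by (simp add: nc_matrices_def)
    finally show False using c(2) lt[OF kn] k by (simp add: K_def)
  qed
  then show ?thesis using invertible_inj[OF Mc] by blast
qed

text \<open>Full rank of the product forces \<open>G\<close> to be invertible, so the change of
  basis can be undone.\<close>

lemma cspan_cols_mult_right:
  fixes M :: "complex mat"
  assumes M: "M \<in> carrier_mat n r" and G: "G \<in> carrier_mat r r" and rank: "vec_space.rank n (M * G) = r"
  shows "cspan n (set (cols (M * G))) = cspan n (set (cols M))"
proof -
  have MG: "M * G \<in> carrier_mat n r" using M G by simp
  have mult: "(M * G) *\<^sub>v c = M *\<^sub>v (G *\<^sub>v c)" if "c \<in> carrier_vec r" for c
    using M G that by simp
  have "c = 0\<^sub>v r" if c: "c \<in> carrier_vec r" "G *\<^sub>v c = 0\<^sub>v r" for c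
  proof -
    have "(M * G) *\<^sub>v c = 0\<^sub>v n" unfolding mult[OF c(1)] c(2) using M by (intro eq_vecI) auto
    then show ?thesis using full_rank_iff_inj[OF MG] rank c(1) by blast
  qed
  then have "det G \<noteq> 0" using det_0_iff_vec_prod_zero_field[OF G] by blast
  then obtain H where H: "H \<in> carrier_mat r r" "G * H = 1\<^sub>m r"
    using det_non_zero_imp_unit[OF G, of "()"] by (auto simp: Units_def ring_mat_simps)
  have expand: "M *\<^sub>v c = (M * G) *\<^sub>v (H *\<^sub>v c)" if c: "c \<in> carrier_vec r" for c
  proof -
    have "G *\<^sub>v (H *\<^sub>v c) = (G * H) *\<^sub>v c" using G H(1) c by simp
    then show ?thesis using mult[of "H *\<^sub>v c"] H c by simp
  qed
  show ?thesis
    unfolding cspan_cols[OF MG] cspan_cols[OF M]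
  proof (intro equalityI subsetI)
    fix v assume "v \<in> {(M * G) *\<^sub>v c | c. c \<in> carrier_vec r}"
    then obtain c where "c \<in> carrier_vec r" "v = (M * G) *\<^sub>v c" by blast
    then show "v \<in> {M *\<^sub>v c | c. c \<in> carrier_vec r}" using mult G by auto
  next
    fix v assume "v \<in> {M *\<^sub>v c | c. c \<in> carrier_vec r}"
    then obtain c where "c \<in> carrier_vec r" "v = M *\<^sub>v c" by blast
    then show "v \<in> {(M * G) *\<^sub>v c | c. c \<in> carrier_vec r}" using expand[of c] H(1) by auto
  qed
qed

section \<open>The two inclusions\<close>

lemma QGr_subset_locus:
  assumes rn: "r \<le> n" and W: "W \<in> QGr r n"
  shows "W \<in> plucker_products_locus r n (johnson_edges r n - quasisymmetric_johnson_edges r n)"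
proof -
  obtain w V where w: "w \<in> NC n" and V: "V \<in> nc_cell n w" and WV: "W = V r"
    using W by (auto simp: QGr_def QFl_def flag_proj_def)
  obtain N M where N: "N \<in> carrier_mat n n" "invertible_mat N" "V = flag_of n N"
    and M: "M \<in> nc_matrices n w" "V = flag_of n M"
    using V by (auto simp: nc_cell_def Fl_def)
  have Mc: "M \<in> carrier_mat n n" using M(1) by (simp add: nc_matrices_def)
  let ?L = "\<lambda>M :: complex mat. mat n r (\<lambda>(i, k). M $$ (i, k))"
  \<comment> \<open>Membership in \<open>Gr\<close> comes from \<open>N\<close>, invertible by the
    definition of \<open>Fl\<close>; the zero pattern comes from \<open>M\<close>.\<close>
  have "plucker_rep r n W (?L N)"
    unfolding plucker_rep_def
    using left_columns_inj[OF N(1,2) rn] left_columns[OF N(1) rn] WV N(3) by (simp add: flag_of_def)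
  then have Gr: "W \<in> Gr r n" by (rule plucker_rep_Gr)
  have WM: "W = cspan n (set (cols (?L M)))"
    using left_columns[OF Mc rn] WV M(2) by (simp add: flag_of_def)
  \<comment> \<open>Any representative is the left part of \<open>M\<close> times a square matrix,
    so its nonzero minors are nonzero minors of \<open>M\<close> as well.\<close>
  have bal: "balanced r n (level_subset.time r n (w ` {..<r})) B"
    if rep: "plucker_rep r n W M'" and B: "B \<in> subsets_of_size r n" and nz: "plucker M' B \<noteq> 0" for M' B
  proof -
    have M': "M' \<in> carrier_mat n r" "W = cspan n (set (cols M'))" using rep by (auto simp: plucker_rep_def)
    interpret vec_space "TYPE(complex)" n .
    have "set (cols M') \<subseteq> carrier_vec n" using M'(1) cols_dim by blast
    then have "set (cols M') \<subseteq> cspan n (set (cols (?L M)))"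
      using in_own_span M'(2) WM by metis
    then obtain G where G: "G \<in> carrier_mat r r" "M' = ?L M * G"
      using plucker_rep_factor[of "?L M" n r M'] M'(1) by auto
    interpret row_selection n r "?L M" B
      using B by unfold_locales (auto simp: subsets_of_size_def)
    have "plucker (?L M) B \<noteq> 0" using plucker_mult[OF G(1)] G(2) nz by auto
    then obtain \<tau> where \<tau>: "bij_betw \<tau> {..<r} B" "\<And>k. k < r \<Longrightarrow> ?L M $$ (\<tau> k, k) \<noteq> 0"
      using plucker_nonzero_matching by blast
    have "M $$ (\<tau> k, k) \<noteq> 0" if "k < r" for k
    proof -
      have "\<tau> k < n" using \<tau>(1) that B by (auto simp: bij_betw_def subsets_of_size_def)
      then show ?thesis using \<tau>(2)[OF that] that by simp
    qed
    then show ?thesis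
      using nc_matrix_balanced[OF w M(1) rn \<tau>(1)] B by (simp add: subsets_of_size_def)
  qed
  have "plucker M' A * plucker M' B = 0"
    if E: "{A, B} \<in> johnson_edges r n - quasisymmetric_johnson_edges r n" and rep: "plucker_rep r n W M'" for A B M'
  proof (rule ccontr)
    assume nz: "plucker M' A * plucker M' B \<noteq> 0"
    obtain C D i j where CD: "{A, B} = {C, D}" "C \<in> subsets_of_size r n" "D \<in> subsets_of_size r n"
      "j \<in> C" "i \<in> {..<n} - C" "D = insert i (C - {j})"
      using E by (auto simp: johnson_edges_def)
    have "plucker M' C \<noteq> 0" "plucker M' D \<noteq> 0" using CD(1) nz by (auto simp: doubleton_eq_iff)
    then have "{C, D} \<in> quasisymmetric_johnson_edges r n"
      using balanced_edge[OF w rn, of C i j] bal[OF rep CD(2)] bal[OF rep CD(3)] CD(2-6)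
      by (auto simp: subsets_of_size_def)
    then show False using E CD(1) by simp
  qed
  then show ?thesis using Gr unfolding plucker_products_locus_def by blast
qed

lemma locus_subset_QGr:
  assumes rn: "r \<le> n"
    and W: "W \<in> plucker_products_locus r n (johnson_edges r n - quasisymmetric_johnson_edges r n)"
  shows "W \<in> QGr r n"
proof -
  have "W \<in> Gr r n" using W by (simp add: plucker_products_locus_def)
  then obtain M where rep: "plucker_rep r n W M" using Gr_plucker_rep by blast
  have M: "M \<in> carrier_mat n r" and rank: "vec_space.rank n M = r" and WM: "W = cspan n (set (cols M))"
    using rep by (auto simp: plucker_rep_def)
  have inj: "\<forall>c\<in>carrier_vec r. M *\<^sub>v c = 0\<^sub>v n \<longrightarrow> c = 0\<^sub>v r"
    using full_rank_iff_inj[OF M] rank by blast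
  define F where "F = {A \<in> subsets_of_size r n. plucker M A \<noteq> 0}"
  have "F \<subseteq> Pow {..<n}" by (auto simp: F_def subsets_of_size_def)
  then have finF: "finite F" using finite_subset by blast
  have "F \<noteq> {}" using ex_nonzero_plucker[OF M inj] by (auto simp: F_def)
  then have "Max ((\<lambda>A. \<Sum>A) ` F) \<in> (\<lambda>A. \<Sum>A) ` F" using finF by (intro Max_in) auto
  \<comment> \<open>\<open>A\<close> maximises the sum of its elements among the nonvanishing
    coordinates.\<close>
  then obtain A where AF: "A \<in> F" and maxA: "Max ((\<lambda>A. \<Sum>A) ` F) = \<Sum>A" by auto
  have max: "\<Sum>B \<le> \<Sum>A" if "B \<in> F" for B
    unfolding maxA[symmetric] using finF that by (intro Max_ge) auto
  have nzA: "plucker M A \<noteq> 0" using AF by (simp add: F_def)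
  interpret level_subset r n A using AF rn by unfold_locales (auto simp: F_def subsets_of_size_def)
  interpret rs: row_selection n r M A using M A by unfold_locales
  obtain c where c: "\<And>j. c j \<in> carrier_vec r"
    "\<And>j b. j \<in> A \<Longrightarrow> b \<in> A \<Longrightarrow> (M *\<^sub>v c j) $ b = (if b = j then 1 else 0)"
    using rs.dual_coefficients[OF nzA] by blast
  \<comment> \<open>A nonzero off-pivot entry of the reduced basis yields a second nonvanishing
    coordinate at a neighbour of \<open>A\<close>; the equations make the pair a quasisymmetric
    edge, and \<open>cell_perm\<close> realises it.\<close>
  have pivot: "i < j \<and> Transposition.transpose i j \<circ> cell_perm \<in> NC n"
    if ij: "j \<in> A" "i \<notin> A" "i < n" "(M *\<^sub>v c j) $ i \<noteq> 0" for i j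
  proof -
    let ?B = "insert i (A - {j})"
    have B: "?B \<subseteq> {..<n}" "card ?B = r" using A ij exchange_card by auto
    interpret B: row_selection n r M ?B using M B by unfold_locales
    have jn: "j < n" using ij A by auto
    have "plucker M ?B \<noteq> 0"
    proof
      assume "plucker M ?B = 0"
      then obtain d where d: "d \<in> carrier_vec r" "d \<noteq> 0\<^sub>v r" "\<And>b. b \<in> ?B \<Longrightarrow> (M *\<^sub>v d) $ b = 0"
        using B.plucker_eq_0_iff by blast
      \<comment> \<open>On \<open>A\<close>, the vector \<open>M *\<^sub>v d\<close> is supported at
        \<open>j\<close>. As the minor at \<open>A\<close> is nonzero, \<open>d\<close> is a
        multiple of \<open>c j\<close>, and the vanishing entry in row \<open>i\<close> makes the
        factor zero.\<close>
      define \<alpha> where "\<alpha> = (M *\<^sub>v d) $ j"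
      have Me: "M *\<^sub>v (d - \<alpha> \<cdot>\<^sub>v c j) = M *\<^sub>v d - \<alpha> \<cdot>\<^sub>v (M *\<^sub>v c j)"
        using mult_minus_distrib_mat_vec[OF M d(1), of "\<alpha> \<cdot>\<^sub>v c j"] mult_mat_vec[OF M c(1)] c(1) by simp
      have "(M *\<^sub>v (d - \<alpha> \<cdot>\<^sub>v c j)) $ b = 0" if b: "b \<in> A" for b
      proof -
        have "b < n" using b A by auto
        then have "(M *\<^sub>v (d - \<alpha> \<cdot>\<^sub>v c j)) $ b = (M *\<^sub>v d) $ b - \<alpha> * (M *\<^sub>v c j) $ b"
          unfolding Me using M by simp
        then show ?thesis using c(2)[OF ij(1) b] d(3)[of b] b by (cases "b = j") (simp_all add: \<alpha>_def)
      qed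
      moreover have "d - \<alpha> \<cdot>\<^sub>v c j \<in> carrier_vec r" using d(1) c(1) by simp
      ultimately have e0: "d - \<alpha> \<cdot>\<^sub>v c j = 0\<^sub>v r" using rs.plucker_eq_0_iff nzA by blast
      have deq: "d $ k = \<alpha> * c j $ k" if "k < r" for k
        using arg_cong[OF e0, of "\<lambda>v. v $ k"] that c(1)[of j] d(1) by simp
      then have "d = \<alpha> \<cdot>\<^sub>v c j" using d(1) c(1)[of j] by (intro eq_vecI) auto
      then have "(M *\<^sub>v d) $ i = \<alpha> * (M *\<^sub>v c j) $ i"
        using mult_mat_vec[OF M c(1)] M ij(3) by simp
      then have "\<alpha> = 0" using d(3)[of i] ij(4) by simp
      then have "d = 0\<^sub>v r" using deq d(1) by (intro eq_vecI) auto
      then show False using d(2) by simp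
    qed
    then have BF: "?B \<in> F" using B by (simp add: F_def subsets_of_size_def)
    \<comment> \<open>The sum changes by \<open>i - j\<close>, so maximality of \<open>A\<close>
      rules out \<open>i > j\<close>.\<close>
    have "\<Sum>?B + j = \<Sum>A + i"
      using ij finite_A sum.remove[of A j id] by (simp add: sum.insert_remove)
    then have "i < j" using max[OF BF] ij(1,2) by (cases "i = j") auto
    have "{A, ?B} \<in> johnson_edges r n"
      unfolding johnson_edges_def subsets_of_size_def using A B ij by blast
    moreover have "plucker M A * plucker M ?B \<noteq> 0" using nzA \<open>plucker M ?B \<noteq> 0\<close> by simp
    ultimately have "{A, ?B} \<in> quasisymmetric_johnson_edges r n"
      using W rep unfolding plucker_products_locus_def by blast
    then show ?thesis
      using \<open>i < j\<close> cell_perm_swap_NC[OF ij(2,1) \<open>i < j\<close>] edge_imp_close[OF ij(2,1) \<open>i < j\<close>] by simp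
  qed
  let ?w = cell_perm
  have w: "?w \<in> NC n" by (rule cell_perm_NC)
  have wA: "?w k \<in> A" if "k < r" for k using cell_perm_image that by auto
  have wlt: "?w k < n" if "k < n" for k using permutes_in_image[OF NC_permutes[OF w], of k] that by simp
  \<comment> \<open>The first \<open>r\<close> columns are the reduced basis, ordered so that column
    \<open>k\<close> has pivot \<open>?w k\<close>; the rest are completed by the permutation matrix
    of \<open>?w\<close>.\<close>
  define N where "N = mat n n (\<lambda>(i, k). if k < r then (M *\<^sub>v c (?w k)) $ i else if i = ?w k then 1 else 0)"
  have N: "N \<in> carrier_mat n n" by (simp add: N_def)
  have N_nc: "N \<in> nc_matrices n ?w"
    unfolding nc_matrices_def
  proof (intro CollectI conjI allI impI)
    show "N \<in> carrier_mat n n" by (rule N)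
    show "N $$ (?w k, k) = 1" if "k < n" for k
      using that wlt[OF that] c(2)[OF wA wA] by (simp add: N_def)
    fix i k
    assume i: "i < n" and k: "k < n" and
      out: "i \<noteq> ?w k \<and> (i, k) \<notin> {(i, Hilbert_Choice.inv ?w j) |i j. (i, j) \<in> Inv_NC n ?w}"
    show "N $$ (i, k) = 0"
    proof (rule ccontr)
      assume nz: "N $$ (i, k) \<noteq> 0"
      then have kr: "k < r" and nz': "(M *\<^sub>v c (?w k)) $ i \<noteq> 0"
        using i k out by (auto simp: N_def split: if_splits)
      have iA: "i \<notin> A"
        using c(2)[OF wA[OF kr], of i] nz' out by auto
      have inv: "Hilbert_Choice.inv ?w (?w k) = k" using NC_inv_eq[OF w] by simp
      \<comment> \<open>A row outside \<open>A\<close> is the pivot of a column from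
        \<open>r\<close> on, hence to the right of column \<open>k\<close>, which makes
        \<open>(i, ?w k)\<close> an inversion.\<close>
      have "r \<le> Hilbert_Choice.inv ?w i"
      proof (rule ccontr)
        assume "\<not> r \<le> Hilbert_Choice.inv ?w i"
        then have "?w (Hilbert_Choice.inv ?w i) \<in> A" using wA by simp
        then show False using iA NC_inv_eq[OF w, of i "Hilbert_Choice.inv ?w i"] by simp
      qed
      then have "(i, ?w k) \<in> Inv_NC n ?w"
        using pivot[OF wA[OF kr] iA i nz'] inv kr i wlt[OF k] by (simp add: Inv_NC_def Inv_def)
      then show False using out inv by force
    qed
  qed
  have Ninv: "invertible_mat N" by (rule nc_matrix_invertible[OF w N_nc])
  define G where "G = mat r r (\<lambda>(i, k). c (?w k) $ i)"
  have G: "G \<in> carrier_mat r r" by (simp add: G_def)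
  have left: "mat n r (\<lambda>(i, k). N $$ (i, k)) = M * G"
  proof (rule eq_matI)
    fix i k assume "i < dim_row (M * G)" "k < dim_col (M * G)"
    then have ik: "i < n" "k < r" using M G by auto
    have "col G k = c (?w k)" using c(1)[of "?w k"] ik by (intro eq_vecI) (auto simp: G_def)
    then show "mat n r (\<lambda>(i, k). N $$ (i, k)) $$ (i, k) = (M * G) $$ (i, k)"
      using ik rn M G by (simp add: N_def)
  qed (use M G in auto)
  have "flag_of n N r = cspan n (set (cols (M * G)))"
    using left_columns[OF N rn] left by (simp add: flag_of_def)
  also have "\<dots> = W"
    using cspan_cols_mult_right[OF M G] left_columns_inj[OF N Ninv rn] left WM by simp
  finally have "flag_proj r (flag_of n N) = W" by (simp add: flag_proj_def)
  moreover have "flag_of n N \<in> QFl n"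
    unfolding QFl_def nc_cell_def Fl_def using w N_nc N Ninv by blast
  ultimately show ?thesis unfolding QGr_def by blast
qed

theorem theorem2:
  fixes r n :: nat
  assumes "r \<le> n"
  shows "QGr r n = plucker_products_locus r n (johnson_edges r n - quasisymmetric_johnson_edges r n)"
  using QGr_subset_locus[OF assms] locus_subset_QGr[OF assms] by blast


end
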